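(* Let $X$ be a proper geodesic space, $x_0\in X$ a basepoint, and $(g_n)$ a sequence of isometries of $X$. Assume that $g_n(x_0)\to p_1$ and $g_n^{-1}(x_0)\to p_2$ for points $p_1,p_2\in\partial_M X_{x_0}$. Let $U$ be any open neighborhood of $p_1$ in $\partial_M X_{x_0}$ and $K\subset\partial_M X_{x_0}$ any compact set with $p_2\notin K$. Then, after passing to a subsequence of $(g_n)$, there exists an integer $k$ such that $g_n(K)\subset U$ for all $n>k$.
   Context: A Morse gauge is a function $N:[1,\infty)\times[0,\infty)\to[0,\infty)$; a (quasi-)geodesic $\gamma$ is $N$-Morse if every $(\lambda,\epsilon)$-quasi-geodesic with endpoints on $\gamma$ lies in the $N(\lambda,\epsilon)$-neighborhood of $\gamma$. The Morse boundary $\partial_M X_{x_0}$ is the set of equivalence classes (finite Hausdorff distance) of Morse geodesic rays based at $x_0$. For a Morse gauge $N$, $\partial_M^N X_{x_0}$ is the subset of classes containing an $N$-Morse ray based at $x_0$, with the quotient of the compact-open topology on $N$-Morse rays based at $x_0$; $\partial_M X_{x_0}=\varinjlim_N\partial_M^N X_{x_0}$ (gauges ordered pointwise) with the direct limit topology. Isometries act on $\partial_M X_{x_0}$ by sending $[\alpha]$ to the class of $g\circ\alpha$. For points $y_n\in X$ and $p\in\partial_M X$, $y_n\to p$ means: there exist a Morse gauge $N$ and geodesics $[x_0,y_n]$ that are all $N$-Morse, such that every subsequence of $([x_0,y_n])$ has a further subsequence converging uniformly on compact sets to a geodesic ray $\gamma$ with $\gamma(0)=x_0$ and $[\gamma]=p$.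 *)

theory Defs
  imports "HOL-Analysis.Analysis"
begin

text \<open>The space X is the whole type 'a (a metric space). Paths are total functions
  real => 'a; only their values on the stated parameter interval matter.\<close>

definition proper_space :: "'a::metric_space itself \<Rightarrow> bool" where
  "proper_space _ \<longleftrightarrow> (\<forall>(x::'a) r. compact (cball x r))"

definition geodesic_on :: "(real \<Rightarrow> 'a::metric_space) \<Rightarrow> real set \<Rightarrow> bool" where
  "geodesic_on c I \<longleftrightarrow> (\<forall>s\<in>I. \<forall>t\<in>I. dist (c s) (c t) = \<bar>s - t\<bar>)"

definition geodesic_space :: "'a::metric_space itself \<Rightarrow> bool" where
  "geodesic_space _ \<longleftrightarrow> (\<forall>x y::'a. \<exists>c. geodesic_on c {0..dist x y} \<and> c 0 = x \<and> c (dist x y) = y)"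

definition isometry_of :: "('a::metric_space \<Rightarrow> 'a) \<Rightarrow> bool" where
  "isometry_of g \<longleftrightarrow> bij g \<and> (\<forall>x y. dist (g x) (g y) = dist x y)"

definition quasi_geodesic_on :: "real \<Rightarrow> real \<Rightarrow> (real \<Rightarrow> 'a::metric_space) \<Rightarrow> real set \<Rightarrow> bool" where
  "quasi_geodesic_on l e q I \<longleftrightarrow>
     (\<forall>s\<in>I. \<forall>t\<in>I. \<bar>s - t\<bar> / l - e \<le> dist (q s) (q t) \<and> dist (q s) (q t) \<le> l * \<bar>s - t\<bar> + e)"

definition morse_gauge :: "(real \<Rightarrow> real \<Rightarrow> real) \<Rightarrow> bool" where
  "morse_gauge N \<longleftrightarrow> (\<forall>l\<ge>1. \<forall>e\<ge>0. N l e \<ge> 0)"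

definition N_morse :: "(real \<Rightarrow> real \<Rightarrow> real) \<Rightarrow> (real \<Rightarrow> 'a::metric_space) \<Rightarrow> real set \<Rightarrow> bool" where
  "N_morse N \<gamma> I \<longleftrightarrow>
     (\<forall>l e q a b. l \<ge> 1 \<and> e \<ge> 0 \<and> a \<le> b \<and> quasi_geodesic_on l e q {a..b}
        \<and> q a \<in> \<gamma> ` I \<and> q b \<in> \<gamma> ` I
        \<longrightarrow> (\<forall>t\<in>{a..b}. infdist (q t) (\<gamma> ` I) \<le> N l e))"

definition geodesic_ray_at :: "'a::metric_space \<Rightarrow> (real \<Rightarrow> 'a) \<Rightarrow> bool" where
  "geodesic_ray_at x0 \<alpha> \<longleftrightarrow> geodesic_on \<alpha> {0..} \<and> \<alpha> 0 = x0"

definition N_morse_rays :: "'a::metric_space \<Rightarrow> (real \<Rightarrow> real \<Rightarrow> real) \<Rightarrow> (real \<Rightarrow> 'a) set" where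
  "N_morse_rays x0 N = {\<alpha>. geodesic_ray_at x0 \<alpha> \<and> N_morse N \<alpha> {0..}}"

definition morse_ray_at :: "'a::metric_space \<Rightarrow> (real \<Rightarrow> 'a) \<Rightarrow> bool" where
  "morse_ray_at x0 \<alpha> \<longleftrightarrow> (\<exists>N. morse_gauge N \<and> \<alpha> \<in> N_morse_rays x0 N)"

definition fin_haus :: "(real \<Rightarrow> 'a::metric_space) \<Rightarrow> (real \<Rightarrow> 'a) \<Rightarrow> bool" where
  "fin_haus \<alpha> \<beta> \<longleftrightarrow> (\<exists>C. (\<forall>t\<ge>0. infdist (\<alpha> t) (\<beta> ` {0..}) \<le> C)
                         \<and> (\<forall>t\<ge>0. infdist (\<beta> t) (\<alpha> ` {0..}) \<le> C))"

definition mclass :: "'a::metric_space \<Rightarrow> (real \<Rightarrow> 'a) \<Rightarrow> (real \<Rightarrow> 'a) set" where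
  "mclass x0 \<alpha> = {\<beta>. morse_ray_at x0 \<beta> \<and> fin_haus \<alpha> \<beta>}"

definition morse_boundary :: "'a::metric_space \<Rightarrow> (real \<Rightarrow> 'a) set set" where
  "morse_boundary x0 = mclass x0 ` {\<alpha>. morse_ray_at x0 \<alpha>}"

definition N_morse_boundary :: "'a::metric_space \<Rightarrow> (real \<Rightarrow> real \<Rightarrow> real) \<Rightarrow> (real \<Rightarrow> 'a) set set" where
  "N_morse_boundary x0 N = mclass x0 ` N_morse_rays x0 N"

definition compact_open_top :: "(real \<Rightarrow> 'a::metric_space) topology" where
  "compact_open_top = topology_generated_by
     {{f. f ` C \<subseteq> V} | C V. compact C \<and> C \<subseteq> {0..} \<and> open V}"

definition quotient_top :: "'a topology \<Rightarrow> ('a \<Rightarrow> 'b) \<Rightarrow> 'b topology" where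
  "quotient_top T q = topology (\<lambda>U. U \<subseteq> q ` topspace T \<and> openin T {x \<in> topspace T. q x \<in> U})"

definition N_morse_boundary_top :: "'a::metric_space \<Rightarrow> (real \<Rightarrow> real \<Rightarrow> real) \<Rightarrow> (real \<Rightarrow> 'a) set topology" where
  "N_morse_boundary_top x0 N =
     quotient_top (subtopology compact_open_top (N_morse_rays x0 N)) (mclass x0)"

definition morse_boundary_top :: "'a::metric_space \<Rightarrow> (real \<Rightarrow> 'a) set topology" where
  "morse_boundary_top x0 = topology (\<lambda>U. U \<subseteq> morse_boundary x0 \<and>
      (\<forall>N. morse_gauge N \<longrightarrow> openin (N_morse_boundary_top x0 N) (U \<inter> N_morse_boundary x0 N)))"

definition boundary_act :: "'a::metric_space \<Rightarrow> ('a \<Rightarrow> 'a) \<Rightarrow> (real \<Rightarrow> 'a) set \<Rightarrow> (real \<Rightarrow> 'a) set" where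
  "boundary_act x0 g p = {\<beta>. morse_ray_at x0 \<beta> \<and> (\<exists>\<alpha>\<in>p. fin_haus (g \<circ> \<alpha>) \<beta>)}"

definition conv_uc :: "(nat \<Rightarrow> real \<Rightarrow> 'a::metric_space) \<Rightarrow> (nat \<Rightarrow> real) \<Rightarrow> (real \<Rightarrow> 'a) \<Rightarrow> bool" where
  "conv_uc c L \<gamma> \<longleftrightarrow> (\<forall>T\<ge>0. \<forall>e>0. eventually (\<lambda>n. T \<le> L n \<and>
       (\<forall>t\<in>{0..T}. dist (c n t) (\<gamma> t) < e)) sequentially)"

definition converges_to_boundary :: "'a::metric_space \<Rightarrow> (nat \<Rightarrow> 'a) \<Rightarrow> (real \<Rightarrow> 'a) set \<Rightarrow> bool" where
  "converges_to_boundary x0 y p \<longleftrightarrow>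
     (\<exists>(N::real \<Rightarrow> real \<Rightarrow> real) (c::nat \<Rightarrow> real \<Rightarrow> 'a). morse_gauge N \<and>
        (\<forall>n. geodesic_on (c n) {0..dist x0 (y n)} \<and> c n 0 = x0 \<and> c n (dist x0 (y n)) = y n
             \<and> N_morse N (c n) {0..dist x0 (y n)}) \<and>
        (\<forall>r::nat \<Rightarrow> nat. strict_mono r \<longrightarrow> (\<exists>s::nat \<Rightarrow> nat. strict_mono s \<and> (\<exists>\<gamma>. geodesic_ray_at x0 \<gamma> \<and> \<gamma> \<in> p \<and>
            conv_uc (\<lambda>n. c (r (s n))) (\<lambda>n. dist x0 (y (r (s n)))) \<gamma>))))"

end

theory Submission
  imports Defs
begin

text \<open>If the claim fails, there are infinitely many \<open>n\<close> and Morse rays \<open>\<alpha>\<^sub>n\<close> with classes in \<open>K\<close>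
  such that \<open>g\<^sub>n\<close> moves the class of \<open>\<alpha>\<^sub>n\<close> outside \<open>U\<close>. A compact set lies in a single stratum and
  contains the classes of limits of rays, so along a subsequence \<open>\<alpha>\<^sub>n\<close> converges to a ray whose class
  differs from \<open>p\<^sub>2\<close>. Hence the geodesics from \<open>x\<^sub>0\<close> to \<open>inv g\<^sub>n x\<^sub>0\<close> diverge from \<open>\<alpha>\<^sub>n\<close> after uniformly
  bounded time, and reversing them and continuing along \<open>\<alpha>\<^sub>n\<close> gives uniform quasi-geodesics whose
  images are uniformly Morse. A geodesic ray close to such a path, translated by \<open>g\<^sub>n\<close>, starts at
  \<open>x\<^sub>0\<close>, represents the image of \<open>\<alpha>\<^sub>n\<close> and passes uniformly close to \<open>g\<^sub>n x\<^sub>0\<close>. So these rays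
  subconverge within one stratum to a ray in \<open>p\<^sub>1\<close>, contradicting that \<open>U\<close> is open.\<close>

section \<open>Morse sets\<close>

text \<open>The obstacle is uniformity. Openness in the direct limit is tested inside one stratum at
  a time, so the rays to which it is finally applied need a common gauge, and no constant may depend
  on \<open>n\<close>. Hausdorff distances of equivalent rays are not bounded, so they enter only
  qualitatively. The quantitative tool is to cut a path at a point almost closest to a target and go
  straight to the target: this is a quasi-geodesic whose constants depend only on those of the path.
  For a geodesic they are \<open>(3, 1)\<close>, hence the recurring \<open>N 3 1\<close>.

  Accumulation points in the direct limit do not come with sequences converging to them, so
  compactness is used through closed sets, which are checked stratum by stratum.

  The inverses enter because the isometry that takes \<open>inv g x0\<close> to \<open>x0\<close>
  takes \<open>x0\<close> to \<open>g x0\<close>: the joint of the concatenated path becomes the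
  point by which the translated ray must pass.\<close>

definition morse_set :: "(real \<Rightarrow> real \<Rightarrow> real) \<Rightarrow> 'a::metric_space set \<Rightarrow> bool" where
  "morse_set N S \<longleftrightarrow>
     (\<forall>l e q a b. l \<ge> 1 \<and> e \<ge> 0 \<and> a \<le> b \<and> quasi_geodesic_on l e q {a..b} \<and> q a \<in> S \<and> q b \<in> S
        \<longrightarrow> (\<forall>t\<in>{a..b}. infdist (q t) S \<le> N l e))"

text \<open>The Morse condition sees a path only through its image. With sets, unions,
  Hausdorff-close sets and isometric images need no parametrization.\<close>

lemma N_morse_iff_morse_set: "N_morse N \<gamma> I \<longleftrightarrow> morse_set N (\<gamma> ` I)"
  by (simp add: N_morse_def morse_set_def)

lemma morse_setD:
  assumes "morse_set N S" "1 \<le> l" "0 \<le> e" "quasi_geodesic_on l e q {a..b}"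
    and "q a \<in> S" "q b \<in> S" "a \<le> t" "t \<le> b"
  shows "infdist (q t) S \<le> N l e"
proof -
  have "a \<le> b" "t \<in> {a..b}" using assms by auto
  then show ?thesis using assms unfolding morse_set_def by blast
qed

lemma morse_set_mono:
  assumes "morse_set N S" "\<And>l e. 1 \<le> l \<Longrightarrow> 0 \<le> e \<Longrightarrow> N l e \<le> N' l e"
  shows "morse_set N' S"
  using assms unfolding morse_set_def by (meson order_trans)

lemma infdist_less_witness:
  assumes "S \<noteq> {}" "infdist x S < r"
  obtains y where "y \<in> S" "dist x y < r"
  using assms by (auto simp: infdist_notempty cINF_less_iff)

lemma geodesic_on_imp_quasi_geodesic:
  "geodesic_on c I \<Longrightarrow> quasi_geodesic_on 1 0 c I"
  by (simp add: geodesic_on_def quasi_geodesic_on_def)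

lemma geodesic_on_subset: "geodesic_on c I \<Longrightarrow> J \<subseteq> I \<Longrightarrow> geodesic_on c J"
  by (auto simp: geodesic_on_def)

lemma geodesic_onD:
  "geodesic_on c I \<Longrightarrow> s \<in> I \<Longrightarrow> t \<in> I \<Longrightarrow> dist (c s) (c t) = \<bar>s - t\<bar>"
  by (simp add: geodesic_on_def)

lemma quasi_geodesic_on_subset:
  "quasi_geodesic_on l e q I \<Longrightarrow> J \<subseteq> I \<Longrightarrow> quasi_geodesic_on l e q J"
  by (auto simp: quasi_geodesic_on_def)

lemma quasi_geodesic_on_reverse:
  assumes "quasi_geodesic_on l e q {a..b}"
  shows "quasi_geodesic_on l e (\<lambda>t. q (- t)) {- b..- a}"
  unfolding quasi_geodesic_on_def
proof (intro ballI)
  fix s t assume "s \<in> {- b..- a}" "t \<in> {- b..- a}"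
  then have "- s \<in> {a..b}" "- t \<in> {a..b}" by auto
  then show "\<bar>s - t\<bar> / l - e \<le> dist (q (- s)) (q (- t)) \<and> dist (q (- s)) (q (- t)) \<le> l * \<bar>s - t\<bar> + e"
    using assms unfolding quasi_geodesic_on_def by (metis abs_minus_commute minus_diff_minus abs_minus_cancel)
qed

lemma quasi_geodesic_onD:
  assumes "quasi_geodesic_on l e q I" "s \<in> I" "t \<in> I" "s \<le> t"
  shows "(t - s) / l - e \<le> dist (q s) (q t)" "dist (q s) (q t) \<le> l * (t - s) + e"
proof -
  have "\<bar>s - t\<bar> = t - s" using assms by simp
  then show "(t - s) / l - e \<le> dist (q s) (q t)" "dist (q s) (q t) \<le> l * (t - s) + e"
    using assms unfolding quasi_geodesic_on_def by metis+
qed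

lemma quasi_geodesic_onI:
  assumes "\<And>s t. s \<in> I \<Longrightarrow> t \<in> I \<Longrightarrow> s < t \<Longrightarrow>
     (t - s) / l - e \<le> dist (q s) (q t) \<and> dist (q s) (q t) \<le> l * (t - s) + e"
    and "0 \<le> e"
  shows "quasi_geodesic_on l e q I"
  unfolding quasi_geodesic_on_def
proof (intro ballI)
  fix s t assume st: "s \<in> I" "t \<in> I"
  consider "s < t" | "s = t" | "t < s" by linarith
  then show "\<bar>s - t\<bar> / l - e \<le> dist (q s) (q t) \<and> dist (q s) (q t) \<le> l * \<bar>s - t\<bar> + e"
  proof cases
    case 1 then show ?thesis using assms(1)[OF st 1] by (simp add: abs_if)
  next
    case 2 then show ?thesis using assms(2) by simp
  next
    case 3 then show ?thesis using assms(1)[OF st(2,1) 3] by (simp add: abs_if dist_commute)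
  qed
qed

text \<open>The constants come from the case of two points on different pieces: a point at distance
  \<open>\<sigma>\<close> beyond the joint is at distance at least \<open>\<sigma> - 1\<close> from \<open>q\<close>, because \<open>q m\<close> is almost
  closest to \<open>p\<close>.\<close>

lemma quasi_geodesic_append_projection:
  fixes q c :: "real \<Rightarrow> 'a::metric_space"
  assumes l: "1 \<le> l" and e: "0 \<le> e"
    and q: "quasi_geodesic_on l e q {a..m}"
    and near: "\<And>t. a \<le> t \<Longrightarrow> t \<le> m \<Longrightarrow> dist (q m) p \<le> dist (q t) p + 1"
    and c: "geodesic_on c {0..dist (q m) p}" "c 0 = q m" "c (dist (q m) p) = p"
  shows "quasi_geodesic_on (2 * l + 1) (e + 1) (\<lambda>t. if t \<le> m then q t else c (t - m))
           {a..m + dist (q m) p}"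
proof (rule quasi_geodesic_onI)
  let ?L = "dist (q m) p"
  let ?k = "2 * l + 1"
  let ?q = "\<lambda>t. if t \<le> m then q t else c (t - m)"
  fix s t assume st: "s \<in> {a..m + ?L}" "t \<in> {a..m + ?L}" "s < t"
  have k: "1 \<le> ?k" "l \<le> ?k" using l by auto
  consider "t \<le> m" | "m < s" | "s \<le> m" "m < t" by linarith
  then show "(t - s) / ?k - (e + 1) \<le> dist (?q s) (?q t) \<and> dist (?q s) (?q t) \<le> ?k * (t - s) + (e + 1)"
  proof cases
    case 1
    then have "(t - s) / l - e \<le> dist (q s) (q t)" "dist (q s) (q t) \<le> l * (t - s) + e"
      using quasi_geodesic_onD[OF q, of s t] st 1 by auto
    moreover have "(t - s) / ?k \<le> (t - s) / l" using k l st by (intro divide_left_mono) auto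
    moreover have "l * (t - s) \<le> ?k * (t - s)" using k st by (intro mult_right_mono) auto
    moreover have "dist (?q s) (?q t) = dist (q s) (q t)" using 1 st by auto
    ultimately show ?thesis by (intro conjI) linarith+
  next
    case 2
    have "s - m \<in> {0..?L}" "t - m \<in> {0..?L}" using 2 st by auto
    from geodesic_onD[OF c(1) this] have d: "dist (?q s) (?q t) = t - s" using 2 st by simp
    have "(t - s) / ?k \<le> t - s" using k st by (simp add: divide_le_eq)
    moreover have "1 * (t - s) \<le> ?k * (t - s)" using k st by (intro mult_right_mono) auto
    ultimately show ?thesis using d e by auto
  next
    case 3
    define d where "d = dist (q s) (c (t - m))"
    define \<sigma> where "\<sigma> = t - m"
    have \<sigma>: "0 \<le> \<sigma>" "\<sigma> \<in> {0..?L}" using 3 st by (auto simp: \<sigma>_def)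
    have m0: "0 \<in> {0..?L}" "?L \<in> {0..?L}" by auto
    have cp: "dist (c \<sigma>) p = ?L - \<sigma>" using geodesic_onD[OF c(1) \<sigma>(2) m0(2)] c(3) \<sigma> by auto
    have cm: "dist (q m) (c \<sigma>) = \<sigma>" using geodesic_onD[OF c(1) m0(1) \<sigma>(2)] c(2) \<sigma> by auto
    have qq: "(m - s) / l - e \<le> dist (q s) (q m)" "dist (q s) (q m) \<le> l * (m - s) + e"
      using quasi_geodesic_onD[OF q, of s m] st 3 by auto
    have "?L \<le> dist (q s) p + 1" using near st 3 by auto
    also have "dist (q s) p \<le> d + (?L - \<sigma>)"
      using dist_triangle[of "q s" p "c \<sigma>"] cp by (simp add: d_def \<sigma>_def)
    finally have d1: "\<sigma> \<le> d + 1" by simp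
    have d2: "dist (q s) (q m) \<le> d + \<sigma>"
      using dist_triangle[of "q s" "q m" "c \<sigma>"] cm by (simp add: d_def \<sigma>_def dist_commute)
    have d3: "d \<le> dist (q s) (q m) + \<sigma>"
      using dist_triangle[of "q s" "c \<sigma>" "q m"] cm by (simp add: d_def \<sigma>_def)
    have d0: "0 \<le> d" by (simp add: d_def)
    \<comment> \<open>\<open>t - s\<close> splits into \<open>m - s\<close> and \<sigma>. The first
      is bounded by going from \<open>q s\<close> to \<open>q m\<close> through
      \<open>c \<sigma>\<close>, the second by \<open>d1\<close>; together they grow with slope
      \<open>2 * l + 1\<close> in \<open>d\<close>.\<close>
    have "(m - s) / l \<le> 2 * d + 1 + e" using qq d1 d2 by linarith
    then have "m - s \<le> l * (2 * d + 1 + e)" using l by (simp add: divide_le_eq mult.commute)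
    then have "t - s \<le> l * (2 * d + 1 + e) + (d + 1)" using d1 by (simp add: \<sigma>_def)
    also have "\<dots> \<le> (d + (e + 1)) * ?k"
      using l e mult_nonneg_nonneg[of l e] by (simp add: algebra_simps)
    finally have "(t - s) / ?k \<le> d + (e + 1)" using k by (simp add: divide_le_eq)
    moreover have "d \<le> ?k * (t - s) + (e + 1)"
    proof -
      have "d \<le> l * (m - s) + e + \<sigma>" using d3 qq by linarith
      also have "\<dots> \<le> ?k * (m - s) + e + ?k * \<sigma>"
        using k \<sigma> 3 mult_right_mono[of l ?k "m - s"] mult_right_mono[of 1 ?k \<sigma>] by auto
      also have "\<dots> = ?k * (t - s) + e" by (simp add: \<sigma>_def algebra_simps)
      finally show ?thesis by simp
    qed
    ultimately show ?thesis using 3 by (simp add: d_def)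
  qed
qed (use e in auto)

text \<open>Only one end of \<open>q\<close> lies in \<open>S\<close>. Continuing from the almost
  closest time straight to \<open>p\<close> produces a quasi-geodesic with both ends in
  \<open>S\<close>, of which \<open>q\<close> is a part.\<close>

lemma morse_set_near_projection:
  assumes X: "geodesic_space TYPE('a::metric_space)"
    and S: "morse_set N (S :: 'a set)" and l: "1 \<le> l" and e: "0 \<le> e"
    and q: "quasi_geodesic_on l e q {a..m}" "q a \<in> S" "p \<in> S"
    and near: "\<And>t. a \<le> t \<Longrightarrow> t \<le> m \<Longrightarrow> dist (q m) p \<le> dist (q t) p + 1"
    and t: "a \<le> t" "t \<le> m"
  shows "infdist (q t) S \<le> N (2 * l + 1) (e + 1)"
proof -
  obtain c where c: "geodesic_on c {0..dist (q m) p}" "c 0 = q m" "c (dist (q m) p) = p"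
    using X unfolding geodesic_space_def by blast
  let ?q = "\<lambda>t. if t \<le> m then q t else c (t - m)"
  have Q: "quasi_geodesic_on (2 * l + 1) (e + 1) ?q {a..m + dist (q m) p}"
    by (rule quasi_geodesic_append_projection[OF l e q(1) near c])
  have "?q (m + dist (q m) p) = p" using c by auto
  then have "infdist (?q t) S \<le> N (2 * l + 1) (e + 1)"
    using morse_setD[OF S _ _ Q, of t] l e q t by (simp add: add_increasing2)
  then show ?thesis using t by simp
qed

lemma morse_set_near_projection_right:
  assumes X: "geodesic_space TYPE('a::metric_space)"
    and S: "morse_set N (S :: 'a set)" and l: "1 \<le> l" and e: "0 \<le> e"
    and q: "quasi_geodesic_on l e q {m..b}" "q b \<in> S" "p \<in> S"
    and near: "\<And>t. m \<le> t \<Longrightarrow> t \<le> b \<Longrightarrow> dist (q m) p \<le> dist (q t) p + 1"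
    and t: "m \<le> t" "t \<le> b"
  shows "infdist (q t) S \<le> N (2 * l + 1) (e + 1)"
  using morse_set_near_projection[OF X S l e quasi_geodesic_on_reverse[OF q(1)], of p "- t"]
  using q near t by simp

text \<open>The slack 1 stands in for an attained minimum: quasi-geodesics may be discontinuous and
  \<open>I\<close> may be unbounded.\<close>

lemma almost_closest_time:
  fixes q :: "real \<Rightarrow> 'a::metric_space"
  assumes "I \<noteq> {}"
  obtains m where "m \<in> I" "\<And>t. t \<in> I \<Longrightarrow> dist (q m) p \<le> dist (q t) p + 1"
    "dist (q m) p \<le> infdist p (q ` I) + 1"
proof -
  have "infdist p (q ` I) < infdist p (q ` I) + 1" by simp
  then obtain y where "y \<in> q ` I" "dist p y < infdist p (q ` I) + 1"
    using infdist_less_witness[of "q ` I"] assms by blast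
  then obtain m where m: "m \<in> I" "dist p (q m) < infdist p (q ` I) + 1" by blast
  have "dist (q m) p \<le> dist (q t) p + 1" if "t \<in> I" for t
    using m infdist_le[of "q t" "q ` I" p] that by (simp add: dist_commute)
  with m that show ?thesis by (simp add: dist_commute less_imp_le)
qed

definition union_gauge :: "(real \<Rightarrow> real \<Rightarrow> real) \<Rightarrow> real \<Rightarrow> real \<Rightarrow> real" where
  "union_gauge N = (\<lambda>l e. max (N l e) (N (2 * l + 1) (e + 1)))"

text \<open>Cut the quasi-geodesic at a time almost closest to the common point \<open>p\<close>.
  Each half, continued to \<open>p\<close>, has both ends in a single one of the two sets.\<close>

lemma morse_set_Un:
  assumes X: "geodesic_space TYPE('a::metric_space)"
    and S: "morse_set N (S :: 'a set)" and T: "morse_set N T" and p: "p \<in> S" "p \<in> T"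
  shows "morse_set (union_gauge N) (S \<union> T)"
proof -
  \<comment> \<open>\<open>A\<close> and \<open>B\<close> are the sets holding the start and the end
    of \<open>q\<close>. They may coincide, so all four positions of the ends are treated at
    once.\<close>
  have main: "infdist (q t) (S \<union> T) \<le> union_gauge N l e"
    if l: "1 \<le> l" and e: "0 \<le> e" and q: "quasi_geodesic_on l e q {a..b}"
      and A: "morse_set N A" and B: "morse_set N B" and pAB: "p \<in> A" "p \<in> B"
      and sub: "A \<subseteq> S \<union> T" "B \<subseteq> S \<union> T" and qa: "q a \<in> A" "q b \<in> B" and t: "a \<le> t" "t \<le> b"
    for l e q a b t A B
  proof -
    have "{a..b} \<noteq> {}" using t by auto
    then obtain m where m: "m \<in> {a..b}" "\<And>t. t \<in> {a..b} \<Longrightarrow> dist (q m) p \<le> dist (q t) p + 1"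
      using almost_closest_time[of "{a..b}" q p] by metis
    have "infdist (q t) A \<le> N (2 * l + 1) (e + 1) \<or> infdist (q t) B \<le> N (2 * l + 1) (e + 1)"
    proof (cases "t \<le> m")
      case True
      have "quasi_geodesic_on l e q {a..m}" using q m by (auto intro: quasi_geodesic_on_subset)
      from morse_set_near_projection[OF X A l e this qa(1) pAB(1), of t]
      show ?thesis using m t True by auto
    next
      case False
      have "quasi_geodesic_on l e q {m..b}" using q m by (auto intro: quasi_geodesic_on_subset)
      from morse_set_near_projection_right[OF X B l e this qa(2) pAB(2), of t]
      show ?thesis using m t False by auto
    qed
    moreover have "infdist (q t) (S \<union> T) \<le> infdist (q t) A" "infdist (q t) (S \<union> T) \<le> infdist (q t) B"
      using infdist_mono[of A "S \<union> T"] infdist_mono[of B "S \<union> T"] sub pAB by auto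
    ultimately show ?thesis by (auto simp: union_gauge_def)
  qed
  show ?thesis
    unfolding morse_set_def
  proof (intro allI impI ballI)
    fix l e :: real and q :: "real \<Rightarrow> 'a" and a b t
    assume H: "1 \<le> l \<and> 0 \<le> e \<and> a \<le> b \<and> quasi_geodesic_on l e q {a..b} \<and> q a \<in> S \<union> T \<and> q b \<in> S \<union> T"
      and t: "t \<in> {a..b}"
    obtain A where A: "A = S \<or> A = T" "q a \<in> A" using H by blast
    obtain B where B: "B = S \<or> B = T" "q b \<in> B" using H by blast
    show "infdist (q t) (S \<union> T) \<le> union_gauge N l e"
      by (rule main[of l e q a b A B]) (use A B H t S T p in auto)
  qed
qed

text \<open>Since quasi-geodesics need not be continuous, the two end values can simply be replaced
  by \<open>x\<close> and \<open>y\<close>; this costs \<open>2 * r\<close> in the additive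
  constant.\<close>

lemma morse_set_nbhd:
  assumes S: "morse_set N S" and l: "1 \<le> l" and e: "0 \<le> e" and r: "0 \<le> r"
    and q: "quasi_geodesic_on l e q {a..b}"
    and x: "x \<in> S" "dist (q a) x \<le> r" and y: "y \<in> S" "dist (q b) y \<le> r"
    and t: "a \<le> t" "t \<le> b"
  shows "infdist (q t) S \<le> max (N l (e + 2 * r)) r"
proof -
  \<comment> \<open>At the ends the modified path differs from \<open>q\<close>, but there
    \<open>r\<close> itself is a bound.\<close>
  consider "t = a" | "t = b" | "a < t" "t < b" using t by linarith
  then show ?thesis
  proof cases
    case 1 then show ?thesis using x infdist_le2[of x S "q t" r] by simp
  next
    case 2 then show ?thesis using y infdist_le2[of y S "q t" r] by simp
  next
    case 3
    let ?q = "\<lambda>t. if t = a then x else if t = b then y else q t"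
    have d: "dist (?q s) (q s) \<le> r" for s
      using x y r by (auto simp: dist_commute)
    have "quasi_geodesic_on l (e + 2 * r) ?q {a..b}"
      unfolding quasi_geodesic_on_def
    proof (intro ballI)
      fix s t assume st: "s \<in> {a..b}" "t \<in> {a..b}"
      have "dist (q s) (q t) \<le> dist (?q s) (?q t) + 2 * r"
        using d[of s] d[of t] dist_triangle[of "q s" "q t" "?q s"] dist_triangle[of "?q s" "q t" "?q t"]
        by (smt (verit) dist_commute)
      moreover have "dist (?q s) (?q t) \<le> dist (q s) (q t) + 2 * r"
        using d[of s] d[of t] dist_triangle[of "?q s" "?q t" "q s"] dist_triangle[of "q s" "?q t" "q t"]
        by (smt (verit) dist_commute)
      ultimately show "\<bar>s - t\<bar> / l - (e + 2 * r) \<le> dist (?q s) (?q t) \<and> dist (?q s) (?q t) \<le> l * \<bar>s - t\<bar> + (e + 2 * r)"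
        using q st unfolding quasi_geodesic_on_def by (smt (verit))
    qed
    then have "infdist (?q t) S \<le> N l (e + 2 * r)"
      using morse_setD[OF S l, of "e + 2 * r" ?q a b t] e r x y 3 by simp
    then show ?thesis using 3 by simp
  qed
qed

text \<open>The shift \<open>2 * D\<close> pays for moving two endpoints from the new set to the old
  one, the outer \<open>D\<close> for moving the nearby point back, and 1 for an infimum that may
  not be attained.\<close>

definition hausdorff_gauge :: "(real \<Rightarrow> real \<Rightarrow> real) \<Rightarrow> real \<Rightarrow> real \<Rightarrow> real \<Rightarrow> real" where
  "hausdorff_gauge N D = (\<lambda>l e. max (N l (e + 2 * D)) D + D + 1)"

lemma morse_set_hausdorff:
  assumes S: "morse_set N S" and D: "0 \<le> D"
    and 1: "\<And>x. x \<in> S' \<Longrightarrow> \<exists>y\<in>S. dist x y \<le> D"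
    and 2: "\<And>y. y \<in> S \<Longrightarrow> \<exists>x\<in>S'. dist x y \<le> D"
  shows "morse_set (hausdorff_gauge N D) S'"
  unfolding morse_set_def
proof (intro allI impI ballI)
  fix l e :: real and q :: "real \<Rightarrow> 'a" and a b t
  assume H: "1 \<le> l \<and> 0 \<le> e \<and> a \<le> b \<and> quasi_geodesic_on l e q {a..b} \<and> q a \<in> S' \<and> q b \<in> S'"
    and t: "t \<in> {a..b}"
  obtain x y where xy: "x \<in> S" "dist (q a) x \<le> D" "y \<in> S" "dist (q b) y \<le> D"
    using 1 H by meson
  have "infdist (q t) S < max (N l (e + 2 * D)) D + 1"
    using morse_set_nbhd[OF S _ _ D _ xy, of l e t] H t by auto
  then obtain z where z: "z \<in> S" "dist (q t) z < max (N l (e + 2 * D)) D + 1"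
    using infdist_less_witness[of S] xy by blast
  obtain w where w: "w \<in> S'" "dist w z \<le> D" using 2 z by blast
  have "dist (q t) w \<le> max (N l (e + 2 * D)) D + 1 + D"
    using z w dist_triangle[of "q t" w z] by (simp add: dist_commute)
  then show "infdist (q t) S' \<le> hausdorff_gauge N D l e"
    using w by (intro infdist_le2[of w]) (auto simp: hausdorff_gauge_def)
qed

lemma morse_gauge_union: "morse_gauge N \<Longrightarrow> morse_gauge (union_gauge N)"
  by (auto simp: morse_gauge_def union_gauge_def le_max_iff_disj)

lemma morse_gauge_hausdorff: "0 \<le> D \<Longrightarrow> morse_gauge (hausdorff_gauge N D)"
  by (auto simp: morse_gauge_def hausdorff_gauge_def)

lemma morse_gauge_nonneg: "morse_gauge N \<Longrightarrow> 1 \<le> l \<Longrightarrow> 0 \<le> e \<Longrightarrow> 0 \<le> N l e"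
  by (simp add: morse_gauge_def)

section \<open>Fellow travelling\<close>

text \<open>These are the 1-Lipschitz \<open>(1, M)\<close>-quasi-geodesics: given the Lipschitz
  bound, the lower bound from time 0 spreads to all pairs by the triangle inequality. Geodesics have
  \<open>M = 0\<close>.\<close>

definition quasi_ray :: "real \<Rightarrow> (real \<Rightarrow> 'a::metric_space) \<Rightarrow> real set \<Rightarrow> bool" where
  "quasi_ray M P I \<longleftrightarrow> 0 \<in> I \<and> I \<subseteq> {0..} \<and> 0 \<le> M \<and>
     (\<forall>u\<in>I. \<forall>v\<in>I. dist (P u) (P v) \<le> \<bar>u - v\<bar>) \<and> (\<forall>u\<in>I. u - M \<le> dist (P 0) (P u))"

lemma geodesic_on_quasi_ray:
  "geodesic_on c I \<Longrightarrow> 0 \<in> I \<Longrightarrow> I \<subseteq> {0..} \<Longrightarrow> quasi_ray 0 c I"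
  by (auto simp: quasi_ray_def geodesic_on_def)

text \<open>If \<open>P u\<close> is the point near \<open>y\<close>, then \<open>u\<close> and
  \<open>s\<close> both measure the distance from \<open>P 0\<close>, up to \<open>M\<close> and the
  distance of \<open>y\<close> to \<open>P u\<close>. So \<bar>u - s\<bar> is at most
  \<open>R + 1 + M\<close>, and \<open>P u\<close> can be exchanged for \<open>P s\<close>.\<close>

lemma quasi_ray_synchronize:
  assumes P: "quasi_ray M P I" and y: "dist (P 0) y = s" "infdist y (P ` I) \<le> R" and s: "s \<in> I"
  shows "dist y (P s) \<le> 2 * R + M + 2"
proof -
  have "P ` I \<noteq> {}" "infdist y (P ` I) < R + 1" using s y by auto
  then obtain z where z: "z \<in> P ` I" "dist y z < R + 1"
    by (rule infdist_less_witness)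
  then obtain u where u: "u \<in> I" "dist y (P u) < R + 1" by blast
  have "0 \<in> I" "I \<subseteq> {0..}" using P by (simp_all add: quasi_ray_def)
  then have 0: "0 \<in> I" "0 \<le> u" using u by auto
  have lip: "dist (P v) (P w) \<le> \<bar>v - w\<bar>" if "v \<in> I" "w \<in> I" for v w
    using P that by (simp add: quasi_ray_def)
  have "u - M \<le> dist (P 0) (P u)" using P u by (simp add: quasi_ray_def)
  moreover have "dist (P 0) (P u) \<le> u" "dist (P u) (P s) \<le> \<bar>u - s\<bar>"
    using lip[OF 0(1) u(1)] lip[OF u(1) s] 0(2) by auto
  moreover have "dist (P 0) (P u) \<le> s + dist y (P u)" "s \<le> dist (P 0) (P u) + dist y (P u)"
    using dist_triangle[of "P 0" "P u" y] dist_triangle[of "P 0" y "P u"] y(1) by (auto simp: dist_commute)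
  moreover have "dist y (P s) \<le> dist y (P u) + dist (P u) (P s)" by (rule dist_triangle)
  moreover have "0 \<le> M" using P by (simp add: quasi_ray_def)
  ultimately show ?thesis using u by linarith
qed

text \<open>The Morse property keeps \<eta> near the image of \<open>P\<close>, and synchronization
  turns this into closeness at equal times. The bound does not involve the length
  \<open>L\<close>.\<close>

lemma geodesic_fellow_travels_quasi_ray:
  assumes S: "morse_set N (P ` I)" and P: "quasi_ray M P I"
    and \<eta>: "geodesic_on \<eta> {0..L}" "\<eta> 0 = P 0" and y: "y \<in> P ` I" "dist (\<eta> L) y \<le> r" and r: "0 \<le> r"
    and s: "0 \<le> s" "s \<le> L" "s \<in> I"
  shows "dist (\<eta> s) (P s) \<le> 2 * max (N 1 (2 * r)) r + M + 2"
proof (rule quasi_ray_synchronize[OF P _ _ s(3)])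
  show "dist (P 0) (\<eta> s) = s" using geodesic_onD[OF \<eta>(1), of 0 s] \<eta>(2) s by auto
  have "P 0 \<in> P ` I" using P by (auto simp: quasi_ray_def)
  then show "infdist (\<eta> s) (P ` I) \<le> max (N 1 (2 * r)) r"
    using morse_set_nbhd[OF S _ _ r geodesic_on_imp_quasi_geodesic[OF \<eta>(1)] _ _ y, of "P 0" s] s \<eta> r
    by simp
qed

section \<open>Equivalence of Morse rays\<close>

lemma N_morse_rays_iff:
  "\<alpha> \<in> N_morse_rays x0 N \<longleftrightarrow> geodesic_on \<alpha> {0..} \<and> \<alpha> 0 = x0 \<and> morse_set N (\<alpha> ` {0..})"
  by (auto simp: N_morse_rays_def geodesic_ray_at_def N_morse_iff_morse_set)

lemma N_morse_rays_mono:
  assumes "\<alpha> \<in> N_morse_rays x0 N" "\<And>l e. 1 \<le> l \<Longrightarrow> 0 \<le> e \<Longrightarrow> N l e \<le> N' l e"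
  shows "\<alpha> \<in> N_morse_rays x0 N'"
  using assms morse_set_mono[of N _ N'] by (auto simp: N_morse_rays_iff)

lemma ray_quasi_ray: "geodesic_on c {0..} \<Longrightarrow> quasi_ray 0 c {0..}"
  by (rule geodesic_on_quasi_ray) auto

lemma geodesic_ray_dist:
  "geodesic_on \<alpha> {0..} \<Longrightarrow> 0 \<le> s \<Longrightarrow> 0 \<le> t \<Longrightarrow> dist (\<alpha> s) (\<alpha> t) = \<bar>s - t\<bar>"
  by (simp add: geodesic_on_def)

lemma fin_haus_close:
  assumes "\<And>t. 0 \<le> t \<Longrightarrow> dist (\<alpha> t) (\<beta> t) \<le> C"
  shows "fin_haus \<alpha> \<beta>"
  unfolding fin_haus_def
proof (intro exI[of _ C] conjI allI impI)
  fix t :: real assume t: "0 \<le> t"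
  show "infdist (\<alpha> t) (\<beta> ` {0..}) \<le> C"
    using assms[OF t] t by (intro infdist_le2[of "\<beta> t"]) auto
  show "infdist (\<beta> t) (\<alpha> ` {0..}) \<le> C"
    using assms[OF t] t by (intro infdist_le2[of "\<alpha> t"]) (auto simp: dist_commute)
qed

lemma fin_haus_refl: "fin_haus \<alpha> \<alpha>"
  by (rule fin_haus_close[of _ _ 0]) simp

lemma fin_haus_sym: "fin_haus \<alpha> \<beta> \<Longrightarrow> fin_haus \<beta> \<alpha>"
  unfolding fin_haus_def by blast

lemma infdist_le_via:
  assumes "S \<noteq> {}" "infdist x S \<le> C" "\<And>y. y \<in> S \<Longrightarrow> infdist y S' \<le> C'"
  shows "infdist x S' \<le> C + C'"
proof (rule field_le_epsilon)
  fix e :: real assume "0 < e"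
  then obtain y where y: "y \<in> S" "dist x y < C + e"
    using infdist_less_witness[of S x "C + e"] assms by auto
  then show "infdist x S' \<le> C + C' + e"
    using infdist_triangle[of x S' y] assms(3)[of y] by auto
qed

lemma fin_haus_trans:
  assumes "fin_haus \<alpha> \<beta>" "fin_haus \<beta> \<gamma>"
  shows "fin_haus \<alpha> \<gamma>"
proof -
  obtain C where C: "\<And>t. 0 \<le> t \<Longrightarrow> infdist (\<alpha> t) (\<beta> ` {0..}) \<le> C"
      "\<And>t. 0 \<le> t \<Longrightarrow> infdist (\<beta> t) (\<alpha> ` {0..}) \<le> C"
    using assms(1) unfolding fin_haus_def by blast
  obtain D where D: "\<And>t. 0 \<le> t \<Longrightarrow> infdist (\<beta> t) (\<gamma> ` {0..}) \<le> D"
      "\<And>t. 0 \<le> t \<Longrightarrow> infdist (\<gamma> t) (\<beta> ` {0..}) \<le> D"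
    using assms(2) unfolding fin_haus_def by blast
  show ?thesis
    unfolding fin_haus_def
  proof (intro exI[of _ "C + D"] conjI allI impI)
    fix t :: real assume t: "0 \<le> t"
    show "infdist (\<alpha> t) (\<gamma> ` {0..}) \<le> C + D"
      by (rule infdist_le_via[of "\<beta> ` {0..}"]) (use C D t in auto)
    have "infdist (\<gamma> t) (\<alpha> ` {0..}) \<le> D + C"
      by (rule infdist_le_via[of "\<beta> ` {0..}"]) (use C D t in auto)
    then show "infdist (\<gamma> t) (\<alpha> ` {0..}) \<le> C + D" by simp
  qed
qed

lemma mclass_eq_iff:
  assumes "morse_ray_at x0 \<beta>"
  shows "mclass x0 \<alpha> = mclass x0 \<beta> \<longleftrightarrow> fin_haus \<alpha> \<beta>"
  using assms fin_haus_refl fin_haus_sym fin_haus_trans unfolding mclass_def by blast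

lemma mclass_eq_of_mem:
  assumes "p \<in> morse_boundary x0" "\<gamma> \<in> p"
  shows "morse_ray_at x0 \<gamma>" "p = mclass x0 \<gamma>"
proof -
  obtain \<alpha> where \<alpha>: "p = mclass x0 \<alpha>" using assms(1) by (auto simp: morse_boundary_def)
  then show "morse_ray_at x0 \<gamma>" using assms(2) by (simp add: mclass_def)
  then show "p = mclass x0 \<gamma>" using assms(2) \<alpha> mclass_eq_iff[of x0 \<gamma> \<alpha>] by (simp add: mclass_def)
qed

text \<open>The unknown Hausdorff bound only decides how far out to look. From an almost closest
  point of \<beta> to a distant \<open>\<alpha> s\<close>, a segment leads back to \<alpha>; the
  result is a \<open>(3, 1)\<close>-quasi-geodesic containing \<open>\<beta> t\<close>, with both
  ends on \<alpha>.\<close>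

lemma equivalent_rays_fellow_travel:
  assumes X: "geodesic_space TYPE('a::metric_space)"
    and \<alpha>: "(\<alpha> :: real \<Rightarrow> 'a) \<in> N_morse_rays x0 N" and \<beta>: "geodesic_ray_at x0 \<beta>"
    and eq: "fin_haus \<alpha> \<beta>" and t: "0 \<le> t"
  shows "dist (\<alpha> t) (\<beta> t) \<le> 2 * N 3 1 + 2"
proof -
  have A: "geodesic_on \<alpha> {0..}" "\<alpha> 0 = x0" "morse_set N (\<alpha> ` {0..})"
    using \<alpha> by (auto simp: N_morse_rays_iff)
  have B: "geodesic_on \<beta> {0..}" "\<beta> 0 = x0" using \<beta> by (auto simp: geodesic_ray_at_def)
  obtain C where C: "\<And>t. 0 \<le> t \<Longrightarrow> infdist (\<alpha> t) (\<beta> ` {0..}) \<le> C"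
    using eq unfolding fin_haus_def by blast
  have C0: "0 \<le> C" using C[OF order_refl] infdist_nonneg order_trans by blast
  \<comment> \<open>The projection time \<open>m\<close> of \<open>\<alpha> s\<close> is at least
    \<open>s - (C + 1)\<close>, so this choice puts it beyond \<open>t\<close>.\<close>
  define s where "s = t + C + 2"
  have s: "0 \<le> s" using t C0 by (simp add: s_def)
  obtain m where m: "m \<in> {0..}" "\<And>t. t \<in> {0..} \<Longrightarrow> dist (\<beta> m) (\<alpha> s) \<le> dist (\<beta> t) (\<alpha> s) + 1"
      "dist (\<beta> m) (\<alpha> s) \<le> infdist (\<alpha> s) (\<beta> ` {0..}) + 1"
    using almost_closest_time[of "{0..}" \<beta> "\<alpha> s"] by auto
  have "s \<le> m + (C + 1)"
  proof -
    have "dist x0 (\<alpha> s) = s" using geodesic_ray_dist[OF A(1), of 0 s] A(2) s by simp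
    moreover have "dist x0 (\<beta> m) = m" using geodesic_ray_dist[OF B(1), of 0 m] B(2) m(1) by simp
    ultimately show ?thesis using dist_triangle[of x0 "\<alpha> s" "\<beta> m"] m(3) C[OF s] by linarith
  qed
  then have tm: "t \<le> m" by (simp add: s_def)
  have "quasi_geodesic_on 1 0 \<beta> {0..m}"
    by (rule geodesic_on_imp_quasi_geodesic, rule geodesic_on_subset[OF B(1)]) auto
  moreover have "x0 \<in> \<alpha> ` {0..}" using A(2) by (auto intro: image_eqI[of _ _ 0])
  ultimately have "infdist (\<beta> t) (\<alpha> ` {0..}) \<le> N 3 1"
    using morse_set_near_projection[OF X A(3), of 1 0 \<beta> 0 m "\<alpha> s" t] m(2) t tm s B(2) by simp
  then have "dist (\<beta> t) (\<alpha> t) \<le> 2 * N 3 1 + 0 + 2"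
    using quasi_ray_synchronize[OF ray_quasi_ray[OF A(1)], of "\<beta> t" t "N 3 1"]
      geodesic_ray_dist[OF B(1), of 0 t] A(2) B(2) t by simp
  then show ?thesis by (simp add: dist_commute)
qed

lemma equivalent_rays_morse:
  assumes X: "geodesic_space TYPE('a::metric_space)"
    and N: "morse_gauge N"
    and \<alpha>: "(\<alpha> :: real \<Rightarrow> 'a) \<in> N_morse_rays x0 N" and \<beta>: "geodesic_ray_at x0 \<beta>"
    and eq: "fin_haus \<alpha> \<beta>"
  shows "\<beta> \<in> N_morse_rays x0 (hausdorff_gauge N (2 * N 3 1 + 2))"
proof -
  have "0 \<le> 2 * N 3 1 + 2" using morse_gauge_nonneg[OF N, of 3 1] by simp
  then have "morse_set (hausdorff_gauge N (2 * N 3 1 + 2)) (\<beta> ` {0..})"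
  proof (rule morse_set_hausdorff[rotated])
    show "morse_set N (\<alpha> ` {0..})" using \<alpha> by (simp add: N_morse_rays_iff)
    show "\<exists>y\<in>\<alpha> ` {0..}. dist x y \<le> 2 * N 3 1 + 2" if "x \<in> \<beta> ` {0..}" for x
    proof -
      obtain t where "0 \<le> t" "x = \<beta> t" using \<open>x \<in> \<beta> ` {0..}\<close> by auto
      then show ?thesis
        using equivalent_rays_fellow_travel[OF X \<alpha> \<beta> eq, of t]
        by (intro bexI[of _ "\<alpha> t"]) (auto simp: dist_commute)
    qed
    show "\<exists>x\<in>\<beta> ` {0..}. dist x y \<le> 2 * N 3 1 + 2" if "y \<in> \<alpha> ` {0..}" for y
    proof -
      obtain t where "0 \<le> t" "y = \<alpha> t" using \<open>y \<in> \<alpha> ` {0..}\<close> by auto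
      then show ?thesis
        using equivalent_rays_fellow_travel[OF X \<alpha> \<beta> eq, of t]
        by (intro bexI[of _ "\<beta> t"]) (auto simp: dist_commute)
    qed
  qed
  then show ?thesis using \<beta> by (simp add: N_morse_rays_iff geodesic_ray_at_def)
qed

section \<open>Limits of geodesics\<close>

lemma conv_ucD:
  assumes "conv_uc c L \<gamma>" "0 < e" "0 \<le> T"
  shows "\<forall>\<^sub>F n in sequentially. T \<le> L n \<and> (\<forall>t\<in>{0..T}. dist (c n t) (\<gamma> t) < e)"
  using assms by (simp add: conv_uc_def)

lemma conv_uc_subseq:
  assumes "conv_uc c L \<gamma>" "strict_mono s"
  shows "conv_uc (\<lambda>n. c (s n)) (\<lambda>n. L (s n)) \<gamma>"
  unfolding conv_uc_def
proof (intro allI impI)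
  fix T e :: real assume "0 \<le> T" "0 < e"
  from eventually_subseq[OF assms(2) conv_ucD[OF assms(1) this(2,1)]]
  show "\<forall>\<^sub>F n in sequentially. T \<le> L (s n) \<and> (\<forall>t\<in>{0..T}. dist (c (s n) t) (\<gamma> t) < e)" .
qed

lemma limit_of_morse_rays:
  assumes c: "\<And>n. c n \<in> N_morse_rays x0 N" and conv: "conv_uc c L \<gamma>"
    and \<gamma>: "geodesic_ray_at x0 \<gamma>"
  shows "\<gamma> \<in> N_morse_rays x0 (hausdorff_gauge N 1)"
proof -
  have "morse_set (hausdorff_gauge N 1) (\<gamma> ` {0..})"
    unfolding morse_set_def
  proof (intro allI impI ballI)
    fix l e :: real and q :: "real \<Rightarrow> 'a" and a b t
    assume H: "1 \<le> l \<and> 0 \<le> e \<and> a \<le> b \<and> quasi_geodesic_on l e q {a..b} \<and> q a \<in> \<gamma> ` {0..} \<and> q b \<in> \<gamma> ` {0..}"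
      and t: "t \<in> {a..b}"
    obtain s u where su: "0 \<le> s" "q a = \<gamma> s" "0 \<le> u" "q b = \<gamma> u" using H by auto
    define R where "R = max (N l (e + 2)) 1"
    \<comment> \<open>\<open>T\<close> exceeds both endpoint times and every time \<open>v\<close>
      at which \<open>c n v\<close> is within \<open>R + 1\<close> of \<open>q t\<close>, because
      \<open>v\<close> is the distance from \<open>x0\<close> to \<open>c n v\<close>.\<close>
    define T where "T = s + u + (dist x0 (q t) + R + 1)"
    have R: "0 \<le> R" by (simp add: R_def)
    then have T: "0 \<le> T" "s \<le> T" "u \<le> T" "dist x0 (q t) + R + 1 \<le> T" using su by (auto simp: T_def)
    obtain n where "T \<le> L n \<and> (\<forall>v\<in>{0..T}. dist (c n v) (\<gamma> v) < 1)"
      using eventually_happens'[OF sequentially_bot conv_ucD[OF conv zero_less_one T(1)]] by blast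
    then have n: "dist (c n v) (\<gamma> v) < 1" if "0 \<le> v" "v \<le> T" for v using that by simp
    have cn: "geodesic_on (c n) {0..}" "c n 0 = x0" "morse_set N (c n ` {0..})"
      using c[of n] by (auto simp: N_morse_rays_iff)
    have "dist (q a) (c n s) \<le> 1" "dist (q b) (c n u) \<le> 1"
      using n[of s] n[of u] su T by (auto simp: dist_commute)
    then have "infdist (q t) (c n ` {0..}) < R + 1"
      using morse_set_nbhd[OF cn(3), of l e 1 q a b "c n s" "c n u" t] H t su
      by (auto simp: R_def)
    then obtain y where y: "y \<in> c n ` {0..}" "dist (q t) y < R + 1"
      by (rule infdist_less_witness[rotated]) auto
    then obtain v where v: "0 \<le> v" "dist (q t) (c n v) < R + 1" by auto
    have "v \<le> T"
      using dist_triangle[of x0 "c n v" "q t"] geodesic_ray_dist[OF cn(1), of 0 v] v cn T by auto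
    then have "dist (q t) (\<gamma> v) \<le> R + 2"
      using n[of v] v dist_triangle[of "q t" "\<gamma> v" "c n v"] by auto
    then show "infdist (q t) (\<gamma> ` {0..}) \<le> hausdorff_gauge N 1 l e"
      using v by (intro infdist_le2[of "\<gamma> v"]) (auto simp: hausdorff_gauge_def R_def)
  qed
  then show ?thesis using \<gamma> by (simp add: N_morse_rays_iff geodesic_ray_at_def)
qed

lemma compact_PiE_UNIV:
  fixes S :: "'i \<Rightarrow> 'a::topological_space set"
  assumes "\<And>i. compact (S i)"
  shows "compact {f. \<forall>i. f i \<in> S i}"
proof -
  have "compactin (product_topology (\<lambda>i. euclidean) UNIV) (PiE UNIV S)"
    using assms by (subst compactin_PiE) auto
  moreover have "PiE UNIV S = {f. \<forall>i. f i \<in> S i}" by (auto simp: PiE_UNIV_domain)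
  ultimately show ?thesis by (simp add: euclidean_product_topology)
qed

text \<open>Tychonoff gives compactness, and a countable index makes the product metrizable, so
  compactness becomes sequential. It is applied with rational times as indices.\<close>

lemma pointwise_subsequence:
  fixes f :: "nat \<Rightarrow> 'i::countable \<Rightarrow> 'a::metric_space"
  assumes "\<And>i. compact (S i)" "\<And>n i. f n i \<in> S i"
  obtains r l where "strict_mono (r :: nat \<Rightarrow> nat)" "\<And>i. (\<lambda>n. f (r n) i) \<longlonglongrightarrow> l i"
proof -
  have "seq_compact {f. \<forall>i. f i \<in> S i}"
    using compact_PiE_UNIV[of S, OF assms(1)] by (simp add: compact_eq_seq_compact_metric)
  then obtain l r where r: "strict_mono r" "(f \<circ> r) \<longlonglongrightarrow> l"
    by (rule seq_compactE[of _ f]) (use assms(2) in auto)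
  have "(\<lambda>n. f (r n) i) \<longlonglongrightarrow> l i" for i
  proof -
    have "isCont (\<lambda>x. x i) l"
      using continuous_on_product_coordinates[of i] continuous_on_eq_continuous_at[OF open_UNIV] by blast
    from isCont_tendsto_compose[OF this r(2)] show ?thesis by (simp add: o_def)
  qed
  with r(1) that show ?thesis by blast
qed

text \<open>Equicontinuity carries the Cauchy property from a nearby rational time to
  \<open>t\<close>; completeness of closed balls then supplies the limit.\<close>

lemma lipschitz_convergent:
  fixes h :: "nat \<Rightarrow> real \<Rightarrow> 'a::metric_space"
  assumes X: "proper_space TYPE('a)"
    and lip: "\<And>n s t. dist (h n s) (h n t) \<le> \<bar>s - t\<bar>" and base: "\<And>n. h n 0 = x0"
    and rat: "\<And>q. convergent (\<lambda>n. h n (of_rat q))"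
  shows "convergent (\<lambda>n. h n t)"
proof -
  have "Cauchy (\<lambda>n. h n t)"
    unfolding Cauchy_def
  proof (intro allI impI)
    fix e :: real assume e: "0 < e"
    obtain q where q: "t < of_rat q" "of_rat q < t + e / 3"
      using of_rat_dense[of t "t + e / 3"] e by auto
    have "Cauchy (\<lambda>n. h n (of_rat q))" using rat by (rule convergent_Cauchy)
    then obtain k where k: "\<And>m n. k \<le> m \<Longrightarrow> k \<le> n \<Longrightarrow> dist (h m (of_rat q)) (h n (of_rat q)) < e / 3"
      unfolding Cauchy_def using e by (meson divide_pos_pos zero_less_numeral)
    have near: "dist (h m t) (h m (of_rat q)) < e / 3" for m
      using lip[of m t "of_rat q"] q by auto
    have "dist (h m t) (h n t) < e" if mn: "k \<le> m" "k \<le> n" for m n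
    proof -
      have "dist (h m t) (h n t) \<le> dist (h m t) (h m (of_rat q)) + dist (h m (of_rat q)) (h n t)"
        by (rule dist_triangle)
      also have "dist (h m (of_rat q)) (h n t) \<le> dist (h m (of_rat q)) (h n (of_rat q)) + dist (h n (of_rat q)) (h n t)"
        by (rule dist_triangle)
      finally show ?thesis using near[of m] near[of n] k[OF mn] by (simp add: dist_commute)
    qed
    then show "\<exists>M. \<forall>m\<ge>M. \<forall>n\<ge>M. dist (h m t) (h n t) < e" by blast
  qed
  moreover have "complete (cball x0 \<bar>t\<bar>)"
    using X compact_imp_complete unfolding proper_space_def by blast
  moreover have "h n t \<in> cball x0 \<bar>t\<bar>" for n using lip[of n 0 t] base[of n] by simp
  ultimately obtain l where "(\<lambda>n. h n t) \<longlonglongrightarrow> l" using completeE by metis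
  then show ?thesis by (rule convergentI)
qed

lemma lipschitz_tendsto_uniform:
  fixes h :: "nat \<Rightarrow> real \<Rightarrow> 'a::metric_space"
  assumes lip: "\<And>n s t. dist (h n s) (h n t) \<le> \<bar>s - t\<bar>"
    and lim: "\<And>t. (\<lambda>n. h n t) \<longlonglongrightarrow> \<gamma> t" and e: "0 < e"
  shows "\<forall>\<^sub>F n in sequentially. \<forall>t\<in>{0..T}. dist (h n t) (\<gamma> t) < e"
proof -
  have lip': "dist (\<gamma> s) (\<gamma> t) \<le> \<bar>s - t\<bar>" for s t
    by (rule Lim_bounded[OF tendsto_dist[OF lim lim], of 0]) (use lip in auto)
  \<comment> \<open>A finite grid of mesh \<open>e / 3\<close> covering \<open>{0..T}\<close>:
    pointwise convergence on it is uniform, and the Lipschitz bounds fill the gaps.\<close>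
  let ?F = "(\<lambda>k::nat. real k * (e / 3)) ` {..nat \<lceil>3 * T / e\<rceil>}"
  have "\<forall>\<^sub>F n in sequentially. \<forall>s\<in>?F. dist (h n s) (\<gamma> s) < e / 3"
    using tendstoD[OF lim, of "e / 3"] e by (intro eventually_ball_finite ballI) simp_all
  then show ?thesis
  proof eventually_elim
    fix n assume n: "\<forall>s\<in>?F. dist (h n s) (\<gamma> s) < e / 3"
    show "\<forall>t\<in>{0..T}. dist (h n t) (\<gamma> t) < e"
    proof
      fix t assume t: "t \<in> {0..T}"
      define k where "k = nat \<lfloor>3 * t / e\<rfloor>"
      have pos: "0 \<le> 3 * t / e" using t e by auto
      have k: "real k \<le> 3 * t / e" "3 * t / e < real k + 1" using pos unfolding k_def by linarith+
      have "3 * t / e \<le> 3 * T / e" using t e by (simp add: divide_right_mono)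
      then have "k \<le> nat \<lceil>3 * T / e\<rceil>" using k by linarith
      then have 1: "dist (h n (real k * (e / 3))) (\<gamma> (real k * (e / 3))) < e / 3" using n by blast
      have "real k * (e / 3) \<le> t" "t < real k * (e / 3) + e / 3" using k e by (auto simp: field_simps)
      then have 2: "\<bar>t - real k * (e / 3)\<bar> < e / 3" by simp
      have "dist (h n t) (\<gamma> t) \<le> dist (h n t) (h n (real k * (e / 3))) + dist (h n (real k * (e / 3))) (\<gamma> t)"
        by (rule dist_triangle)
      also have "dist (h n (real k * (e / 3))) (\<gamma> t)
          \<le> dist (h n (real k * (e / 3))) (\<gamma> (real k * (e / 3))) + dist (\<gamma> (real k * (e / 3))) (\<gamma> t)"
        by (rule dist_triangle)
      finally show "dist (h n t) (\<gamma> t) < e"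
        using 1 2 lip[of n t "real k * (e / 3)"] lip'[of "real k * (e / 3)" t] by linarith
    qed
  qed
qed

lemma geodesics_subconverge:
  fixes c :: "nat \<Rightarrow> real \<Rightarrow> 'a::metric_space"
  assumes X: "proper_space TYPE('a)"
    and c: "\<And>n. geodesic_on (c n) {0..L n}" "\<And>n. c n 0 = x0"
    and L: "\<And>n. 0 \<le> L n" "filterlim L at_top sequentially"
  obtains r \<gamma> where "strict_mono (r :: nat \<Rightarrow> nat)" "geodesic_ray_at x0 \<gamma>"
    "conv_uc (\<lambda>n. c (r n)) (\<lambda>n. L (r n)) \<gamma>"
proof -
  \<comment> \<open>Clamping the time extends every segment to a 1-Lipschitz map of the whole line,
    so that all maps share one domain. Since \<open>L\<close> tends to infinity, the clamp is
    eventually inactive at each nonnegative time.\<close>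
  define h where "h n t = c n (max 0 (min t (L n)))" for n t
  have h_eq: "h n t = c n t" if "0 \<le> t" "t \<le> L n" for n t using that by (simp add: h_def)
  have base: "h n 0 = x0" for n using L c by (simp add: h_def)
  have lip: "dist (h n s) (h n t) \<le> \<bar>s - t\<bar>" for n s t
  proof -
    have "max 0 (min s (L n)) \<in> {0..L n}" "max 0 (min t (L n)) \<in> {0..L n}" using L(1)[of n] by auto
    from geodesic_onD[OF c(1) this] show ?thesis unfolding h_def by linarith
  qed
  have "h n (of_rat q) \<in> cball x0 \<bar>of_rat q\<bar>" for n q
    using lip[of n 0 "of_rat q"] base by simp
  moreover have "compact (cball x0 r)" for r
    using X by (simp add: proper_space_def)
  ultimately obtain r l where r: "strict_mono (r :: nat \<Rightarrow> nat)"
      and l: "\<And>q. (\<lambda>n. h (r n) (of_rat q)) \<longlonglongrightarrow> l q"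
    using pointwise_subsequence[of "\<lambda>q. cball x0 \<bar>of_rat q\<bar>" "\<lambda>n q. h n (of_rat q)"] by metis
  have "convergent (\<lambda>n. h (r n) t)" for t
    by (rule lipschitz_convergent[OF X lip base]) (use l in \<open>auto simp: convergent_def\<close>)
  then obtain \<gamma> where \<gamma>: "\<And>t. (\<lambda>n. h (r n) t) \<longlonglongrightarrow> \<gamma> t" unfolding convergent_def by metis
  have Lr: "filterlim (\<lambda>n. L (r n)) at_top sequentially"
    using filterlim_compose[OF L(2) filterlim_subseq[OF r]] .
  then have ev: "\<forall>\<^sub>F n in sequentially. T \<le> L (r n)" for T by (simp add: filterlim_at_top)
  have "geodesic_on \<gamma> {0..}"
    unfolding geodesic_on_def
  proof (intro ballI)
    fix s t :: real assume st: "s \<in> {0..}" "t \<in> {0..}"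
    have "\<forall>\<^sub>F n in sequentially. dist (h (r n) s) (h (r n) t) = \<bar>s - t\<bar>"
      using ev[of "max s t"]
    proof eventually_elim
      case (elim n)
      then show ?case using h_eq st geodesic_onD[OF c(1), of s "r n" t] by auto
    qed
    then have "(\<lambda>n. dist (h (r n) s) (h (r n) t)) \<longlonglongrightarrow> \<bar>s - t\<bar>" by (rule tendsto_eventually)
    then show "dist (\<gamma> s) (\<gamma> t) = \<bar>s - t\<bar>"
      using tendsto_dist[OF \<gamma> \<gamma>] LIMSEQ_unique by blast
  qed
  moreover have "\<gamma> 0 = x0" using \<gamma>[of 0] base LIMSEQ_unique[of "\<lambda>n. x0"] by auto
  moreover have "conv_uc (\<lambda>n. c (r n)) (\<lambda>n. L (r n)) \<gamma>"
    unfolding conv_uc_def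
  proof (intro allI impI)
    fix T e :: real assume "0 \<le> T" and e: "0 < e"
    show "\<forall>\<^sub>F n in sequentially. T \<le> L (r n) \<and> (\<forall>t\<in>{0..T}. dist (c (r n) t) (\<gamma> t) < e)"
      using ev[of T] lipschitz_tendsto_uniform[OF lip \<gamma> e, of T]
    proof eventually_elim
      case (elim n)
      then show ?case using h_eq by auto
    qed
  qed
  ultimately show ?thesis using that r by (simp add: geodesic_ray_at_def)
qed

lemma rays_subconverge:
  fixes c :: "nat \<Rightarrow> real \<Rightarrow> 'a::metric_space"
  assumes X: "proper_space TYPE('a)" and c: "\<And>n. geodesic_ray_at x0 (c n)"
  obtains r L \<gamma> where "strict_mono (r :: nat \<Rightarrow> nat)" "geodesic_ray_at x0 \<gamma>"
    "conv_uc (\<lambda>n. c (r n)) L \<gamma>"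
proof -
  have "geodesic_on (c n) {0..real n}" "c n 0 = x0" for n
    using c[of n] by (auto simp: geodesic_ray_at_def intro: geodesic_on_subset)
  then show ?thesis
    using geodesics_subconverge[OF X, of c real x0 thesis] filterlim_real_sequentially that by simp
qed

section \<open>Concatenation at a common basepoint\<close>

text \<open>Geodesics from \<open>P 0\<close> to \<open>P k\<close> fellow travel \<open>P\<close>
  with a bound free of \<open>k\<close>, because they end exactly on it. A subsequential limit is
  the ray, and passing to it costs 1 more.\<close>

lemma ray_near_quasi_ray:
  fixes P :: "real \<Rightarrow> 'a::metric_space"
  assumes X: "proper_space TYPE('a)" "geodesic_space TYPE('a)" and N: "morse_gauge N"
    and S: "morse_set N (P ` {0..})" and P: "quasi_ray M P {0..}"
  obtains \<beta> where "geodesic_ray_at (P 0) \<beta>" "\<And>s. 0 \<le> s \<Longrightarrow> dist (\<beta> s) (P s) \<le> 2 * N 1 0 + M + 3"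
proof -
  define L where "L k = dist (P 0) (P (real k))" for k
  have "\<exists>c. geodesic_on c {0..L k} \<and> c 0 = P 0 \<and> c (L k) = P (real k)" for k
    using X(2) unfolding geodesic_space_def L_def by blast
  then obtain \<eta> where \<eta>: "\<And>k. geodesic_on (\<eta> k) {0..L k}" "\<And>k. \<eta> k 0 = P 0"
      "\<And>k. \<eta> k (L k) = P (real k)" by metis
  have N0: "0 \<le> N 1 0" using N by (simp add: morse_gauge_def)
  have "real k - M \<le> L k" for k using P by (simp add: quasi_ray_def L_def)
  moreover have "filterlim (\<lambda>k. - M + real k) at_top sequentially"
    by (rule filterlim_tendsto_add_at_top[OF tendsto_const filterlim_real_sequentially])
  ultimately have L: "filterlim L at_top sequentially"
    by (auto intro: filterlim_at_top_mono)
  have close: "dist (\<eta> k s) (P s) \<le> 2 * N 1 0 + M + 2" if "0 \<le> s" "s \<le> L k" for k s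
    using geodesic_fellow_travels_quasi_ray[OF S P \<eta>(1,2), of "P (real k)" k 0 s] that N0 \<eta>(3)
    by simp
  obtain r \<beta> where r: "strict_mono (r :: nat \<Rightarrow> nat)" and \<beta>: "geodesic_ray_at (P 0) \<beta>"
      and conv: "conv_uc (\<lambda>n. \<eta> (r n)) (\<lambda>n. L (r n)) \<beta>"
    using geodesics_subconverge[OF X(1) \<eta>(1,2) _ L] by (auto simp: L_def)
  have "dist (\<beta> s) (P s) \<le> 2 * N 1 0 + M + 3" if s: "0 \<le> s" for s
  proof -
    obtain n where n: "s \<le> L (r n) \<and> (\<forall>t\<in>{0..s}. dist (\<eta> (r n) t) (\<beta> t) < 1)"
      using eventually_happens'[OF sequentially_bot conv_ucD[OF conv zero_less_one s]] by blast
    then have "dist (\<eta> (r n) s) (\<beta> s) < 1" using s by auto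
    then show ?thesis
      using close[OF s, of "r n"] n dist_triangle[of "\<beta> s" "P s" "\<eta> (r n) s"] by (simp add: dist_commute)
  qed
  with \<beta> that show ?thesis by blast
qed

text \<open>A geodesic from \<open>c L\<close> to \<open>\<alpha> t\<close> has a point close to both \<open>c\<close> and \<open>\<alpha>\<close>, namely an almost
  closest point to \<open>x0\<close>. Since \<open>c\<close> and \<open>\<alpha>\<close> are far apart at time \<open>T\<close>, this point is near \<open>x0\<close>.\<close>

lemma diverging_gromov_product_bound:
  fixes c \<alpha> :: "real \<Rightarrow> 'a::metric_space"
  assumes X: "geodesic_space TYPE('a)" and N: "morse_gauge N"
    and c: "geodesic_on c {0..L}" "c 0 = x0" "morse_set N (c ` {0..L})"
    and \<alpha>: "\<alpha> \<in> N_morse_rays x0 N"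
    and T: "0 \<le> T" "T \<le> L"
    and far: "2 * max (N 1 (2 * (4 * N 3 1 + 4))) (4 * N 3 1 + 4) + 2 < dist (c T) (\<alpha> T)"
    and t: "0 \<le> t"
  shows "L + t - 2 * (T + N 3 1 + 1) \<le> dist (c L) (\<alpha> t)"
proof -
  have A: "geodesic_on \<alpha> {0..}" "\<alpha> 0 = x0" "morse_set N (\<alpha> ` {0..})"
    using \<alpha> by (auto simp: N_morse_rays_iff)
  define R where "R = N 3 1"
  have R: "0 \<le> R" using N by (simp add: R_def morse_gauge_def)
  define l where "l = dist (c L) (\<alpha> t)"
  obtain \<eta> where \<eta>: "geodesic_on \<eta> {0..l}" "\<eta> 0 = c L" "\<eta> l = \<alpha> t"
    using X unfolding geodesic_space_def l_def by blast
  have l: "0 \<le> l" by (simp add: l_def)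
  then have "{0..l} \<noteq> {}" by simp
  then obtain m where m: "m \<in> {0..l}" "\<And>s. s \<in> {0..l} \<Longrightarrow> dist (\<eta> m) x0 \<le> dist (\<eta> s) x0 + 1"
    using almost_closest_time[of "{0..l}" \<eta> x0] by metis
  have x0: "x0 \<in> c ` {0..L}" "x0 \<in> \<alpha> ` {0..}" using c(2) A(2) T by (auto intro: image_eqI[of _ _ 0])
  have "quasi_geodesic_on 1 0 \<eta> {0..m}" "quasi_geodesic_on 1 0 \<eta> {m..l}"
    using m(1) geodesic_on_subset[OF \<eta>(1)] by (auto intro!: geodesic_on_imp_quasi_geodesic)
  moreover have "\<eta> 0 \<in> c ` {0..L}" "\<eta> l \<in> \<alpha> ` {0..}" using \<eta> T t by auto
  ultimately have "infdist (\<eta> m) (c ` {0..L}) \<le> R" "infdist (\<eta> m) (\<alpha> ` {0..}) \<le> R"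
    using morse_set_near_projection[OF X c(3), of 1 0 \<eta> 0 m x0 m]
      morse_set_near_projection_right[OF X A(3), of 1 0 \<eta> m l x0 m] m x0
    by (auto simp: R_def)
  then have inf: "infdist (\<eta> m) (c ` {0..L}) < R + 1" "infdist (\<eta> m) (\<alpha> ` {0..}) < R + 1" by auto
  obtain y where "y \<in> c ` {0..L}" "dist (\<eta> m) y < R + 1"
    by (rule infdist_less_witness[OF _ inf(1)]) (use x0 in auto)
  then obtain s1 where s1: "0 \<le> s1" "s1 \<le> L" "dist (\<eta> m) (c s1) < R + 1" by auto
  obtain y where "y \<in> \<alpha> ` {0..}" "dist (\<eta> m) y < R + 1"
    by (rule infdist_less_witness[OF _ inf(2)]) (use x0 in auto)
  then obtain t1 where t1: "0 \<le> t1" "dist (\<eta> m) (\<alpha> t1) < R + 1" by auto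
  have ds1: "dist x0 (c s1) = s1" using geodesic_onD[OF c(1), of 0 s1] c(2) s1 by auto
  have dt1: "dist x0 (\<alpha> t1) = t1" using geodesic_ray_dist[OF A(1), of 0 t1] A(2) t1 by auto
  have ct: "dist (c s1) (\<alpha> t1) \<le> 2 * R + 2"
    using s1 t1 dist_triangle[of "c s1" "\<alpha> t1" "\<eta> m"] by (simp add: dist_commute)
  \<comment> \<open>Points of \<open>c\<close> and \<alpha> that are close to each other lie at
    nearly equal times. Hence \<open>\<alpha> s1\<close> is within \<open>4 * R + 4\<close> of
    \<open>c s1\<close>, which is the endpoint error inside \<open>far\<close>; were
    \<open>T\<close> at most \<open>s1\<close>, fellow travelling would contradict
    \<open>far\<close>.\<close>
  have "\<bar>s1 - t1\<bar> \<le> 2 * R + 2"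
    using ct ds1 dt1 dist_triangle[of x0 "c s1" "\<alpha> t1"] dist_triangle[of x0 "\<alpha> t1" "c s1"]
    by (simp add: dist_commute abs_le_iff)
  then have "dist (\<alpha> s1) (c s1) \<le> 4 * R + 4"
    using ct geodesic_ray_dist[OF A(1) s1(1) t1(1)] dist_triangle[of "\<alpha> s1" "c s1" "\<alpha> t1"]
    by (simp add: dist_commute)
  then have near: "dist (\<alpha> T) (c T) \<le> 2 * max (N 1 (2 * (4 * R + 4))) (4 * R + 4) + 2" if "T \<le> s1"
    using geodesic_fellow_travels_quasi_ray[OF c(3) geodesic_on_quasi_ray[OF c(1)], of \<alpha> s1 "c s1" "4 * R + 4" T]
      geodesic_on_subset[OF A(1), of "{0..s1}"] A(2) c(2) s1 T R that by auto
  have "s1 < T"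
    using near far by (auto simp: R_def dist_commute not_le[symmetric])
  then have x0w: "dist x0 (\<eta> m) \<le> T + R + 1"
    using ds1 s1 dist_triangle[of x0 "\<eta> m" "c s1"] by (simp add: dist_commute)
  \<comment> \<open>Going from each end of \<eta> to \<open>x0\<close> through
    \<open>\<eta> m\<close> gives \<open>L + t\<close> at most \<open>l\<close> plus twice the
    distance from \<open>x0\<close> to \<open>\<eta> m\<close>.\<close>
  have "dist (c L) x0 = L" using geodesic_onD[OF c(1), of L 0] c(2) T by auto
  moreover have "dist x0 (\<alpha> t) = t" using geodesic_ray_dist[OF A(1), of 0 t] A(2) t by auto
  moreover have "dist (c L) (\<eta> m) = m" using geodesic_onD[OF \<eta>(1), of 0 m] \<eta>(2) m(1) by auto
  moreover have "dist (\<eta> m) (\<alpha> t) = l - m" using geodesic_onD[OF \<eta>(1), of m l] \<eta>(3) m(1) by auto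
  ultimately show ?thesis
    using x0w dist_triangle[of "c L" x0 "\<eta> m"] dist_triangle[of x0 "\<alpha> t" "\<eta> m"]
    by (simp add: R_def l_def dist_commute)
qed

text \<open>The path runs from the far end of \<open>c\<close>, so an isometry taking
  \<open>c L\<close> to \<open>x0\<close> makes it start at the basepoint; it passes the joint at
  time \<open>L\<close>.\<close>

definition concat_path :: "real \<Rightarrow> (real \<Rightarrow> 'a) \<Rightarrow> (real \<Rightarrow> 'a) \<Rightarrow> real \<Rightarrow> 'a" where
  "concat_path L c \<alpha> = (\<lambda>s. if s \<le> L then c (L - s) else \<alpha> (s - L))"

lemma concat_path_image:
  assumes "0 \<le> L" "c 0 = \<alpha> 0"
  shows "concat_path L c \<alpha> ` {0..} = c ` {0..L} \<union> \<alpha> ` {0..}"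
proof
  show "concat_path L c \<alpha> ` {0..} \<subseteq> c ` {0..L} \<union> \<alpha> ` {0..}"
    by (auto simp: concat_path_def)
  have "c s \<in> concat_path L c \<alpha> ` {0..}" if "s \<in> {0..L}" for s
    using that by (intro image_eqI[of _ _ "L - s"]) (auto simp: concat_path_def)
  moreover have "\<alpha> t \<in> concat_path L c \<alpha> ` {0..}" if "t \<in> {0..}" for t
    using that assms by (intro image_eqI[of _ _ "L + t"]) (auto simp: concat_path_def)
  ultimately show "c ` {0..L} \<union> \<alpha> ` {0..} \<subseteq> concat_path L c \<alpha> ` {0..}" by blast
qed

text \<open>Up to time \<open>L\<close> the path is a geodesic from its start. Beyond it, the lower
  bound from the start is the hypothesis on \<open>M\<close> at \<open>t = u - L\<close>.\<close>

lemma concat_path_quasi_ray: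
  assumes c: "geodesic_on c {0..L}" and \<alpha>: "geodesic_on \<alpha> {0..}" and L: "0 \<le> L" and eq: "c 0 = \<alpha> 0"
    and M: "0 \<le> M" "\<And>t. 0 \<le> t \<Longrightarrow> L + t - M \<le> dist (c L) (\<alpha> t)"
  shows "quasi_ray M (concat_path L c \<alpha>) {0..}"
proof -
  let ?P = "concat_path L c \<alpha>"
  have lip: "dist (?P u) (?P v) \<le> v - u" if uv: "0 \<le> u" "u \<le> v" for u v
  proof -
    consider "v \<le> L" | "L < u" | "u \<le> L" "L < v" by linarith
    then show ?thesis
    proof cases
      case 1 then show ?thesis
        using geodesic_onD[OF c, of "L - u" "L - v"] uv by (simp add: concat_path_def)
    next
      case 2 then show ?thesis
        using geodesic_ray_dist[OF \<alpha>, of "u - L" "v - L"] uv by (simp add: concat_path_def)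
    next
      case 3
      have "dist (c (L - u)) (c 0) = L - u" using geodesic_onD[OF c, of "L - u" 0] uv 3 L by simp
      moreover have "dist (\<alpha> 0) (\<alpha> (v - L)) = v - L" using geodesic_ray_dist[OF \<alpha>, of 0 "v - L"] 3 by simp
      ultimately show ?thesis
        using dist_triangle[of "c (L - u)" "\<alpha> (v - L)" "c 0"] eq 3 by (simp add: concat_path_def)
    qed
  qed
  have "dist (?P u) (?P v) \<le> \<bar>u - v\<bar>" if "0 \<le> u" "0 \<le> v" for u v
    using lip[of u v] lip[of v u] that by (cases "u \<le> v") (auto simp: dist_commute)
  moreover have "u - M \<le> dist (?P 0) (?P u)" if "0 \<le> u" for u
  proof (cases "u \<le> L")
    case True
    then have "dist (?P 0) (?P u) = u"
      using geodesic_onD[OF c, of L "L - u"] that L by (simp add: concat_path_def)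
    then show ?thesis using M by simp
  next
    case False
    then show ?thesis using M(2)[of "u - L"] L by (simp add: concat_path_def)
  qed
  ultimately show ?thesis using M by (simp add: quasi_ray_def)
qed

section \<open>Isometries\<close>

lemma isometry_dist: "isometry_of g \<Longrightarrow> dist (g x) (g y) = dist x y"
  by (simp add: isometry_of_def)

lemma isometry_surj: "isometry_of g \<Longrightarrow> g (inv g x) = x"
  by (simp add: isometry_of_def bij_is_surj surj_f_inv_f)

lemma isometry_inv_dist:
  assumes "isometry_of g"
  shows "dist (inv g x) (inv g y) = dist x y"
  using isometry_dist[OF assms, of "inv g x" "inv g y"] isometry_surj[OF assms] by simp

lemma isometry_infdist: "isometry_of g \<Longrightarrow> infdist (g x) (g ` S) = infdist x S"
  by (simp add: infdist_def isometry_dist image_image)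

lemma image_comp_eq: "(g \<circ> f) ` A = g ` f ` A"
  by auto

lemma isometry_geodesic_on: "isometry_of g \<Longrightarrow> geodesic_on c I \<Longrightarrow> geodesic_on (g \<circ> c) I"
  by (simp add: geodesic_on_def isometry_dist)

lemma isometry_fin_haus:
  assumes "isometry_of g" "fin_haus \<alpha> \<beta>"
  shows "fin_haus (g \<circ> \<alpha>) (g \<circ> \<beta>)"
  using assms(2) unfolding fin_haus_def image_comp_eq by (simp add: isometry_infdist[OF assms(1)])

lemma isometry_morse_set:
  assumes g: "isometry_of g" and S: "morse_set N S"
  shows "morse_set N (g ` S)"
  unfolding morse_set_def
proof (intro allI impI ballI)
  fix l e :: real and q and a b t
  assume H: "1 \<le> l \<and> 0 \<le> e \<and> a \<le> b \<and> quasi_geodesic_on l e q {a..b} \<and> q a \<in> g ` S \<and> q b \<in> g ` S"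
    and t: "t \<in> {a..b}"
  have "inj g" using g by (simp add: isometry_of_def bij_is_inj)
  then have "(inv g \<circ> q) a \<in> S" "(inv g \<circ> q) b \<in> S" using H by (auto simp: inv_f_f)
  moreover have "quasi_geodesic_on l e (inv g \<circ> q) {a..b}"
    using H g by (simp add: quasi_geodesic_on_def isometry_inv_dist)
  ultimately have "infdist ((inv g \<circ> q) t) S \<le> N l e"
    using morse_setD[OF S, of l e "inv g \<circ> q" a b t] H t by auto
  then show "infdist (q t) (g ` S) \<le> N l e"
    using isometry_infdist[OF g, of "inv g (q t)" S] isometry_surj[OF g] by simp
qed

text \<open>\<open>g \<circ> \<alpha>\<close> starts at \<open>g x0\<close>, so its class must be
  named by some equivalent \<beta>. The choice of \<alpha> within its class is harmless because
  isometries preserve \<open>fin_haus\<close>.\<close>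

lemma boundary_act_mclass:
  assumes g: "isometry_of g" and \<alpha>: "morse_ray_at x0 \<alpha>" and \<beta>: "fin_haus (g \<circ> \<alpha>) \<beta>"
  shows "boundary_act x0 g (mclass x0 \<alpha>) = mclass x0 \<beta>"
proof -
  have "(\<exists>\<alpha>'\<in>mclass x0 \<alpha>. fin_haus (g \<circ> \<alpha>') \<beta>') \<longleftrightarrow> fin_haus \<beta> \<beta>'" for \<beta>'
  proof
    assume "\<exists>\<alpha>'\<in>mclass x0 \<alpha>. fin_haus (g \<circ> \<alpha>') \<beta>'"
    then obtain \<alpha>' where "fin_haus \<alpha> \<alpha>'" "fin_haus (g \<circ> \<alpha>') \<beta>'" by (auto simp: mclass_def)
    then show "fin_haus \<beta> \<beta>'"
      using isometry_fin_haus[OF g] \<beta> by (meson fin_haus_sym fin_haus_trans)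
  next
    assume "fin_haus \<beta> \<beta>'"
    then have "fin_haus (g \<circ> \<alpha>) \<beta>'" using \<beta> fin_haus_trans by blast
    moreover have "\<alpha> \<in> mclass x0 \<alpha>" using \<alpha> by (simp add: mclass_def fin_haus_refl)
    ultimately show "\<exists>\<alpha>'\<in>mclass x0 \<alpha>. fin_haus (g \<circ> \<alpha>') \<beta>'" by blast
  qed
  then show ?thesis by (simp add: boundary_act_def mclass_def)
qed

text \<open>The concatenation of \<open>c\<close> and \<alpha> has Morse image, as two Morse sets
  meet at \<open>x0\<close>, and \<open>M\<close> makes it a quasi-ray. The geodesic ray near it
  starts at \<open>c L\<close>, which \<open>g\<close> moves to \<open>x0\<close>. The gauge and
  \<open>D\<close> do not involve \<open>L\<close>.\<close>

lemma translated_ray: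
  fixes \<alpha> c :: "real \<Rightarrow> 'a::metric_space"
  assumes X: "proper_space TYPE('a)" "geodesic_space TYPE('a)" and N: "morse_gauge N"
    and g: "isometry_of g" and \<alpha>: "\<alpha> \<in> N_morse_rays x0 N"
    and c: "geodesic_on c {0..L}" "c 0 = x0" "g (c L) = x0" "morse_set N (c ` {0..L})" "0 \<le> L"
    and M: "0 \<le> M" "\<And>t. 0 \<le> t \<Longrightarrow> L + t - M \<le> dist (c L) (\<alpha> t)"
    and D: "D = 2 * union_gauge N 1 0 + M + 3"
  obtains \<beta> where "\<beta> \<in> N_morse_rays x0 (hausdorff_gauge (union_gauge N) D)"
    "fin_haus (g \<circ> \<alpha>) \<beta>" "dist (\<beta> L) (g x0) \<le> D"
proof -
  have A: "geodesic_on \<alpha> {0..}" "\<alpha> 0 = x0" "morse_set N (\<alpha> ` {0..})"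
    using \<alpha> by (auto simp: N_morse_rays_iff)
  define P where "P = concat_path L c \<alpha>"
  have P: "quasi_ray M P {0..}"
    unfolding P_def using concat_path_quasi_ray[OF c(1) A(1) c(5) _ M] c(2) A(2) by simp
  have img: "P ` {0..} = c ` {0..L} \<union> \<alpha> ` {0..}"
    unfolding P_def using concat_path_image[of L c \<alpha>] c A by simp
  have S: "morse_set (union_gauge N) (P ` {0..})"
    unfolding img
    by (rule morse_set_Un[OF X(2) c(4) A(3), of x0]) (use c(2,5) A(2) in \<open>auto intro: image_eqI[of _ _ 0]\<close>)
  have P0: "P 0 = c L" "P L = x0" using c(2,5) by (auto simp: P_def concat_path_def)
  have P\<alpha>: "P (L + t) = \<alpha> t" if "0 \<le> t" for t
    using that c(2) A(2) by (auto simp: P_def concat_path_def)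
  obtain \<beta> where \<beta>: "geodesic_ray_at (P 0) \<beta>" "\<And>s. 0 \<le> s \<Longrightarrow> dist (\<beta> s) (P s) \<le> D"
    using ray_near_quasi_ray[OF X morse_gauge_union[OF N] S P] D by blast
  have D0: "0 \<le> D" using \<beta>(2)[OF order_refl] zero_le_dist order_trans by blast
  have "morse_set (hausdorff_gauge (union_gauge N) D) (\<beta> ` {0..})"
  proof (rule morse_set_hausdorff[OF S D0])
    fix x assume "x \<in> \<beta> ` {0..}"
    then obtain s where "0 \<le> s" "x = \<beta> s" by auto
    then show "\<exists>y\<in>P ` {0..}. dist x y \<le> D" using \<beta>(2) by (intro bexI[of _ "P s"]) auto
  next
    fix y assume "y \<in> P ` {0..}"
    then obtain s where "0 \<le> s" "y = P s" by auto
    then show "\<exists>x\<in>\<beta> ` {0..}. dist x y \<le> D" using \<beta>(2) by (intro bexI[of _ "\<beta> s"]) auto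
  qed
  then have "morse_set (hausdorff_gauge (union_gauge N) D) ((g \<circ> \<beta>) ` {0..})"
    unfolding image_comp_eq by (rule isometry_morse_set[OF g])
  then have "g \<circ> \<beta> \<in> N_morse_rays x0 (hausdorff_gauge (union_gauge N) D)"
    using \<beta>(1) c(3) P0 isometry_geodesic_on[OF g] by (simp add: N_morse_rays_iff geodesic_ray_at_def)
  \<comment> \<open>After time \<open>L\<close> the two rays agree up to \<open>D\<close> with a
    shift by \<open>L\<close>; before it, the new ray stays within \<open>D + L\<close> of
    \<open>x0\<close>. Dependence on \<open>L\<close> is allowed here because only finiteness
    matters.\<close>
  moreover have "fin_haus \<alpha> \<beta>"
    unfolding fin_haus_def
  proof (intro exI[of _ "D + L"] conjI allI impI)
    fix t :: real assume t: "0 \<le> t"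
    have "dist (\<alpha> t) (\<beta> (L + t)) \<le> D + L"
      using \<beta>(2)[of "L + t"] P\<alpha>[OF t] t c(5) by (simp add: dist_commute)
    then show "infdist (\<alpha> t) (\<beta> ` {0..}) \<le> D + L"
      using t c(5) by (intro infdist_le2[of "\<beta> (L + t)"]) auto
    show "infdist (\<beta> t) (\<alpha> ` {0..}) \<le> D + L"
    proof (cases "L \<le> t")
      case True
      have "dist (\<beta> t) (\<alpha> (t - L)) \<le> D + L"
        using \<beta>(2)[OF t] P\<alpha>[of "t - L"] True c(5) by simp
      then show ?thesis using True by (intro infdist_le2[of "\<alpha> (t - L)"]) auto
    next
      case False
      have "dist (P t) (P L) \<le> \<bar>t - L\<bar>" using P t c(5) by (simp add: quasi_ray_def)
      then have "dist (\<beta> t) x0 \<le> D + L"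
        using \<beta>(2)[OF t] P0 False t dist_triangle[of "\<beta> t" x0 "P t"] by simp
      then show ?thesis using A(2) by (intro infdist_le2[of x0]) (auto intro: image_eqI[of _ _ 0])
    qed
  qed
  then have "fin_haus (g \<circ> \<alpha>) (g \<circ> \<beta>)" by (rule isometry_fin_haus[OF g])
  moreover have "dist ((g \<circ> \<beta>) L) (g x0) \<le> D"
    using \<beta>(2)[OF c(5)] P0 by (simp add: isometry_dist[OF g])
  ultimately show ?thesis using that by blast
qed

section \<open>The topology of the Morse boundary\<close>

lemma openin_quotient_top:
  "openin (quotient_top T q) U \<longleftrightarrow> U \<subseteq> q ` topspace T \<and> openin T {x \<in> topspace T. q x \<in> U}"
proof -
  have "istopology (\<lambda>U. U \<subseteq> q ` topspace T \<and> openin T {x \<in> topspace T. q x \<in> U})"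
    unfolding istopology_def
  proof (intro conjI allI impI)
    fix S U
    assume "S \<subseteq> q ` topspace T \<and> openin T {x \<in> topspace T. q x \<in> S}"
      "U \<subseteq> q ` topspace T \<and> openin T {x \<in> topspace T. q x \<in> U}"
    moreover have "{x \<in> topspace T. q x \<in> S \<inter> U} = {x \<in> topspace T. q x \<in> S} \<inter> {x \<in> topspace T. q x \<in> U}"
      by blast
    ultimately show "S \<inter> U \<subseteq> q ` topspace T" "openin T {x \<in> topspace T. q x \<in> S \<inter> U}" by auto
  next
    fix \<K> assume K: "\<forall>S\<in>\<K>. S \<subseteq> q ` topspace T \<and> openin T {x \<in> topspace T. q x \<in> S}"
    moreover have "{x \<in> topspace T. q x \<in> \<Union>\<K>} = (\<Union>S\<in>\<K>. {x \<in> topspace T. q x \<in> S})" by blast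
    ultimately show "\<Union>\<K> \<subseteq> q ` topspace T" "openin T {x \<in> topspace T. q x \<in> \<Union>\<K>}" by auto
  qed
  then show ?thesis by (simp add: quotient_top_def topology_inverse')
qed

lemma topspace_compact_open_top: "topspace compact_open_top = UNIV"
proof -
  have "UNIV \<in> {{f :: real \<Rightarrow> 'a. f ` C \<subseteq> V} |C V. compact C \<and> C \<subseteq> {0..} \<and> open V}"
    by (intro CollectI exI[of _ "{}"]) auto
  then show ?thesis unfolding compact_open_top_def topology_generated_by_topspace by blast
qed

lemma openin_compact_open_eval:
  assumes "0 \<le> t" "open V"
  shows "openin compact_open_top {f. f t \<in> V}"
  unfolding compact_open_top_def
  by (rule topology_generated_by_Basis) (use assms in \<open>auto intro!: exI[of _ "{t}"] exI[of _ V]\<close>)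

lemma openin_N_morse_boundary_top:
  "openin (N_morse_boundary_top x0 N) (U \<inter> N_morse_boundary x0 N) \<longleftrightarrow>
     openin (subtopology compact_open_top (N_morse_rays x0 N)) {\<alpha> \<in> N_morse_rays x0 N. mclass x0 \<alpha> \<in> U}"
proof -
  have "{x \<in> N_morse_rays x0 N. mclass x0 x \<in> U \<and> mclass x0 x \<in> mclass x0 ` N_morse_rays x0 N}
      = {\<alpha> \<in> N_morse_rays x0 N. mclass x0 \<alpha> \<in> U}" by blast
  then show ?thesis
    by (simp add: N_morse_boundary_top_def openin_quotient_top topspace_compact_open_top N_morse_boundary_def)
qed

lemma openin_morse_boundary_top:
  "openin (morse_boundary_top x0) U \<longleftrightarrow> U \<subseteq> morse_boundary x0 \<and>
     (\<forall>N. morse_gauge N \<longrightarrow> openin (subtopology compact_open_top (N_morse_rays x0 N))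
        {\<alpha> \<in> N_morse_rays x0 N. mclass x0 \<alpha> \<in> U})"
proof -
  let ?T = "\<lambda>N. subtopology compact_open_top (N_morse_rays x0 N)"
  let ?pre = "\<lambda>N U. {\<alpha> \<in> N_morse_rays x0 N. mclass x0 \<alpha> \<in> U}"
  have "istopology (\<lambda>U. U \<subseteq> morse_boundary x0 \<and> (\<forall>N. morse_gauge N \<longrightarrow> openin (?T N) (?pre N U)))"
    unfolding istopology_def
  proof (intro conjI allI impI)
    fix S U N
    assume *: "S \<subseteq> morse_boundary x0 \<and> (\<forall>N. morse_gauge N \<longrightarrow> openin (?T N) (?pre N S))"
      "U \<subseteq> morse_boundary x0 \<and> (\<forall>N. morse_gauge N \<longrightarrow> openin (?T N) (?pre N U))"
    then show "S \<inter> U \<subseteq> morse_boundary x0" by blast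
    assume "morse_gauge N"
    then have "openin (?T N) (?pre N S \<inter> ?pre N U)" using * by (intro openin_Int) auto
    moreover have "?pre N (S \<inter> U) = ?pre N S \<inter> ?pre N U" by blast
    ultimately show "openin (?T N) (?pre N (S \<inter> U))" by simp
  next
    fix \<K> N
    assume *: "\<forall>S\<in>\<K>. S \<subseteq> morse_boundary x0 \<and> (\<forall>N. morse_gauge N \<longrightarrow> openin (?T N) (?pre N S))"
    then show "\<Union>\<K> \<subseteq> morse_boundary x0" by blast
    assume "morse_gauge N"
    then have "openin (?T N) (\<Union>S\<in>\<K>. ?pre N S)" using * by (intro openin_Union) auto
    moreover have "?pre N (\<Union>\<K>) = (\<Union>S\<in>\<K>. ?pre N S)" by blast
    ultimately show "openin (?T N) (?pre N (\<Union>\<K>))" by simp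
  qed
  then show ?thesis
    by (simp add: morse_boundary_top_def openin_N_morse_boundary_top topology_inverse')
qed

lemma mclass_in_morse_boundary:
  "morse_gauge N \<Longrightarrow> \<alpha> \<in> N_morse_rays x0 N \<Longrightarrow> mclass x0 \<alpha> \<in> morse_boundary x0"
  by (auto simp: morse_boundary_def morse_ray_at_def)

lemma topspace_morse_boundary_top: "topspace (morse_boundary_top x0) = morse_boundary x0"
proof -
  have "{\<alpha> \<in> N_morse_rays x0 N. mclass x0 \<alpha> \<in> morse_boundary x0}
      = topspace (subtopology compact_open_top (N_morse_rays x0 N))" if "morse_gauge N" for N
    using mclass_in_morse_boundary[OF that] by (auto simp: topspace_compact_open_top)
  then have "openin (morse_boundary_top x0) (morse_boundary x0)"
    unfolding openin_morse_boundary_top by (simp del: topspace_subtopology)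
  moreover have "topspace (morse_boundary_top x0) \<subseteq> morse_boundary x0"
    using openin_topspace openin_morse_boundary_top by blast
  ultimately show ?thesis by (simp add: openin_subset subset_antisym)
qed

text \<open>The gain is that \<open>W\<close> may depend on \<open>N\<close> and only has to avoid
  \<open>C\<close> among \<open>N\<close>-Morse rays; no neighborhood valid for all gauges at once
  is needed.\<close>

lemma closedin_morse_boundaryI:
  assumes C: "C \<subseteq> morse_boundary x0"
    and sep: "\<And>N \<beta>. morse_gauge N \<Longrightarrow> \<beta> \<in> N_morse_rays x0 N \<Longrightarrow> mclass x0 \<beta> \<notin> C \<Longrightarrow>
      \<exists>W. openin compact_open_top W \<and> \<beta> \<in> W \<and> (\<forall>\<beta>'\<in>W \<inter> N_morse_rays x0 N. mclass x0 \<beta>' \<notin> C)"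
  shows "closedin (morse_boundary_top x0) C"
  unfolding closedin_def topspace_morse_boundary_top openin_morse_boundary_top
proof (intro conjI allI impI)
  fix N assume N: "morse_gauge N"
  let ?R = "N_morse_rays x0 N"
  show "openin (subtopology compact_open_top ?R) {\<alpha> \<in> ?R. mclass x0 \<alpha> \<in> morse_boundary x0 - C}"
  proof (subst openin_subopen, intro ballI)
    fix \<beta> assume "\<beta> \<in> {\<alpha> \<in> ?R. mclass x0 \<alpha> \<in> morse_boundary x0 - C}"
    then have \<beta>: "\<beta> \<in> ?R" "mclass x0 \<beta> \<notin> C" by auto
    then obtain W where W: "openin compact_open_top W" "\<beta> \<in> W"
        "\<forall>\<beta>'\<in>W \<inter> ?R. mclass x0 \<beta>' \<notin> C" using sep[OF N] by blast
    have "openin (subtopology compact_open_top ?R) (W \<inter> ?R)"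
      using W(1) by (auto simp: openin_subtopology)
    moreover have "\<beta> \<in> W \<inter> ?R" "W \<inter> ?R \<subseteq> {\<alpha> \<in> ?R. mclass x0 \<alpha> \<in> morse_boundary x0 - C}"
      using \<beta> W mclass_in_morse_boundary[OF N] by auto
    ultimately show "\<exists>T. openin (subtopology compact_open_top ?R) T \<and> \<beta> \<in> T \<and>
        T \<subseteq> {\<alpha> \<in> ?R. mclass x0 \<alpha> \<in> morse_boundary x0 - C}" by blast
  qed
qed (use C in auto)

text \<open>On a generating set, the compact image of \<open>C\<close> under \<gamma> keeps a
  positive distance from the complement of \<open>V\<close>, and uniform convergence uses up this
  margin. Induction over the generation of open sets does the rest.\<close>

lemma conv_uc_eventually_in:
  assumes conv: "conv_uc c L \<gamma>" and \<gamma>: "geodesic_ray_at x0 \<gamma>"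
    and W: "openin compact_open_top W" "\<gamma> \<in> W"
  shows "\<forall>\<^sub>F n in sequentially. c n \<in> W"
  using openin_topology_generated_by[OF W(1)[unfolded compact_open_top_def]] W(2)
proof induction
  case (Int a b)
  then show ?case by (auto intro: eventually_elim2)
next
  case (UN K)
  then obtain k where k: "k \<in> K" "\<gamma> \<in> k" by blast
  from UN.IH[OF this] show ?case by (rule eventually_mono) (use k in blast)
next
  case (Basis s)
  then obtain C V where CV: "s = {f. f ` C \<subseteq> V}" "compact C" "C \<subseteq> {0..}" "open V" by blast
  have "continuous_on C \<gamma>"
    unfolding continuous_on_iff
  proof (intro ballI allI impI)
    fix x e :: real assume "x \<in> C" "0 < e"
    then show "\<exists>d>0. \<forall>x'\<in>C. dist x' x < d \<longrightarrow> dist (\<gamma> x') (\<gamma> x) < e"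
      using \<gamma> CV(3) by (intro exI[of _ e]) (auto simp: geodesic_ray_at_def geodesic_on_def dist_real_def subset_iff)
  qed
  then have "compact (\<gamma> ` C)" using CV(2) by (rule compact_continuous_image)
  moreover have "\<gamma> ` C \<subseteq> V" using Basis CV by simp
  ultimately obtain e where e: "0 < e" "(\<Union>x\<in>\<gamma> ` C. ball x e) \<subseteq> V"
    using compact_subset_open_imp_ball_epsilon_subset[of "\<gamma> ` C" V] CV(4) by blast
  obtain T where T: "\<And>x. x \<in> C \<Longrightarrow> \<bar>x\<bar> \<le> T"
    using compact_imp_bounded[OF CV(2)] by (auto simp: bounded_real)
  \<comment> \<open>For empty \<open>C\<close> the bound \<open>T\<close> may be negative, hence the
    maximum with 0.\<close>
  have "\<forall>\<^sub>F n in sequentially. max T 0 \<le> L n \<and> (\<forall>t\<in>{0..max T 0}. dist (c n t) (\<gamma> t) < e)"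
    by (rule conv_ucD[OF conv e(1)]) simp
  then show ?case
  proof eventually_elim
    case (elim n)
    have "c n t \<in> V" if t: "t \<in> C" for t
    proof -
      have "t \<in> {0..max T 0}" using t T[OF t] CV(3) by auto
      then have "c n t \<in> ball (\<gamma> t) e" using elim by (simp add: dist_commute)
      then show ?thesis using e(2) t by blast
    qed
    then show ?case by (auto simp: CV(1))
  qed
qed simp

text \<open>At some time \<open>t\<close> the inequivalent rays are more than \<open>D + 2\<close>
  apart, where \<open>D\<close> bounds the distance at equal times of any \<open>N\<close>-Morse ray
  from an equivalent ray. One unit is spent on the ball defining \<open>W\<close>, one on
  convergence. The gauges of the \<open>a n\<close> do not enter, so they may vary.\<close>

lemma separate_from_limit:
  fixes \<beta> :: "real \<Rightarrow> 'a::metric_space"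
  assumes X: "geodesic_space TYPE('a)"
    and a: "\<And>n. morse_ray_at x0 (a n)" and conv: "conv_uc a L \<alpha>"
    and \<beta>: "\<beta> \<in> N_morse_rays x0 N" and ne: "\<not> fin_haus \<alpha> \<beta>"
  obtains W k where "openin compact_open_top W" "\<beta> \<in> W"
    "\<And>n \<beta>'. k \<le> n \<Longrightarrow> \<beta>' \<in> W \<Longrightarrow> \<beta>' \<in> N_morse_rays x0 N \<Longrightarrow> mclass x0 \<beta>' \<noteq> mclass x0 (a n)"
proof -
  define D where "D = 2 * N 3 1 + 2"
  obtain t where t: "0 \<le> t" "D + 2 < dist (\<alpha> t) (\<beta> t)"
    using fin_haus_close[of \<alpha> \<beta> "D + 2"] ne by (meson not_le)
  define W where "W = {f. f t \<in> ball (\<beta> t) 1}"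
  have "openin compact_open_top W" unfolding W_def by (rule openin_compact_open_eval) (use t in auto)
  moreover have "\<beta> \<in> W" by (simp add: W_def)
  moreover obtain k where k: "\<And>n. k \<le> n \<Longrightarrow> \<forall>s\<in>{0..t}. dist (a n s) (\<alpha> s) < 1"
    using conv_ucD[OF conv zero_less_one t(1)] unfolding eventually_sequentially by blast
  moreover have "mclass x0 \<beta>' \<noteq> mclass x0 (a n)"
    if n: "k \<le> n" and \<beta>': "\<beta>' \<in> W" "\<beta>' \<in> N_morse_rays x0 N" for n \<beta>'
  proof
    assume "mclass x0 \<beta>' = mclass x0 (a n)"
    then have "fin_haus \<beta>' (a n)" using mclass_eq_iff[OF a] by blast
    moreover have "geodesic_ray_at x0 (a n)" using a by (auto simp: morse_ray_at_def N_morse_rays_def)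
    ultimately have "dist (\<beta>' t) (a n t) \<le> D"
      using equivalent_rays_fellow_travel[OF X \<beta>'(2) _ _ t(1)] by (simp add: D_def)
    moreover have "dist (a n t) (\<alpha> t) < 1" using k[OF n] t by auto
    moreover have "dist (\<beta> t) (\<beta>' t) < 1" using \<beta>' by (simp add: W_def)
    ultimately show False
      using t(2) dist_triangle[of "\<alpha> t" "\<beta> t" "a n t"] dist_triangle[of "a n t" "\<beta> t" "\<beta>' t"]
      by (simp add: dist_commute)
  qed
  ultimately show ?thesis using that by blast
qed

lemma conv_uc_const: "conv_uc (\<lambda>_. \<alpha>) real \<alpha>"
  using eventually_ge_at_top filterlim_real_sequentially
  by (auto simp: conv_uc_def filterlim_at_top)

text \<open>Each class in \<open>F\<close> is separated off as the limit of a constant sequence, and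
  the finitely many neighborhoods are intersected.\<close>

lemma separate_from_finite:
  fixes \<beta> :: "real \<Rightarrow> 'a::metric_space"
  assumes X: "geodesic_space TYPE('a)"
    and F: "finite F" "F \<subseteq> morse_boundary x0"
    and \<beta>: "\<beta> \<in> N_morse_rays x0 N" "morse_gauge N" and ne: "mclass x0 \<beta> \<notin> F"
  shows "\<exists>W. openin compact_open_top W \<and> \<beta> \<in> W \<and> (\<forall>\<beta>'\<in>W \<inter> N_morse_rays x0 N. mclass x0 \<beta>' \<notin> F)"
  using F ne
proof (induction F)
  case empty
  then show ?case using openin_topspace[of compact_open_top] by (auto simp: topspace_compact_open_top)
next
  case (insert p F)
  then obtain W where W: "openin compact_open_top W" "\<beta> \<in> W"
      "\<forall>\<beta>'\<in>W \<inter> N_morse_rays x0 N. mclass x0 \<beta>' \<notin> F" by auto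
  obtain \<alpha> where \<alpha>: "p = mclass x0 \<alpha>" "morse_ray_at x0 \<alpha>"
    using insert.prems by (auto simp: morse_boundary_def)
  have "morse_ray_at x0 \<beta>" using \<beta> by (auto simp: morse_ray_at_def)
  then have "\<not> fin_haus \<alpha> \<beta>" using mclass_eq_iff[of x0 \<beta> \<alpha>] \<alpha>(1) insert.prems by auto
  then obtain V k where V: "openin compact_open_top V" "\<beta> \<in> V"
    "\<And>n \<beta>'. k \<le> (n::nat) \<Longrightarrow> \<beta>' \<in> V \<Longrightarrow> \<beta>' \<in> N_morse_rays x0 N \<Longrightarrow> mclass x0 \<beta>' \<noteq> p"
    using separate_from_limit[OF X, of x0 "\<lambda>_. \<alpha>", OF \<alpha>(2) conv_uc_const \<beta>(1)] \<alpha>(1) by metis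
  have "openin compact_open_top (V \<inter> W)" using V W by auto
  then show ?case using V(2) V(3)[OF order_refl] W by (intro exI[of _ "V \<inter> W"]) auto
qed

text \<open>Limit point compactness phrased by closed sets. A contradiction arises from any closed
  set that contains \<open>A - {x}\<close> but misses \<open>x\<close>.\<close>

lemma compactin_accumulation:
  assumes K: "compactin X K" and A: "infinite A" "A \<subseteq> K"
  obtains x where "x \<in> K" "\<And>C. closedin X C \<Longrightarrow> A - {x} \<subseteq> C \<Longrightarrow> x \<in> C"
proof -
  obtain x where x: "x \<in> K" "x \<in> X derived_set_of A"
    using compactin_imp_Bolzano_Weierstrass[OF K] A by blast
  have "x \<in> C" if C: "closedin X C" "A - {x} \<subseteq> C" for C
  proof (rule ccontr)
    assume "x \<notin> C"
    have xX: "x \<in> topspace X" using K x(1) compactin_subset_topspace by blast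
    have "openin X (topspace X - C)" using C(1) by auto
    then have "\<exists>y. y \<noteq> x \<and> y \<in> A \<and> y \<in> topspace X - C"
      using x(2) xX \<open>x \<notin> C\<close> unfolding in_derived_set_of by blast
    then show False using C(2) by blast
  qed
  with x(1) that show ?thesis by blast
qed

text \<open>If some constant were unbounded over \<open>K\<close>, we could choose infinitely many points of \<open>K\<close>
  of which each stratum contains only finitely many; all subsets of them would be closed.\<close>

lemma compact_in_stratum:
  fixes x0 :: "'a::metric_space"
  assumes X: "geodesic_space TYPE('a)"
    and K: "compactin (morse_boundary_top x0) K"
  obtains N where "morse_gauge N" "\<And>p. p \<in> K \<Longrightarrow> \<exists>\<alpha>\<in>N_morse_rays x0 N. p = mclass x0 \<alpha>"
proof -
  have KB: "K \<subseteq> morse_boundary x0"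
    using compactin_subset_topspace[OF K] by (simp add: topspace_morse_boundary_top)
  have "\<exists>\<alpha>. morse_ray_at x0 \<alpha> \<and> p = mclass x0 \<alpha>" if "p \<in> K" for p
    using that KB by (auto simp: morse_boundary_def)
  then obtain ray where ray: "\<And>p. p \<in> K \<Longrightarrow> morse_ray_at x0 (ray p)" "\<And>p. p \<in> K \<Longrightarrow> p = mclass x0 (ray p)"
    by metis
  \<comment> \<open>The Morse condition for one pair \<open>(l, e)\<close> alone, so that a common
    gauge can be assembled value by value.\<close>
  define Q where "Q l e B p \<longleftrightarrow> (\<forall>q a b t. a \<le> b \<and> quasi_geodesic_on l e q {a..b} \<and> q a \<in> ray p ` {0..}
      \<and> q b \<in> ray p ` {0..} \<and> t \<in> {a..b} \<longrightarrow> infdist (q t) (ray p ` {0..}) \<le> B)" for l e B p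
  have Q_morse: "Q l e (N l e) p" if "ray p \<in> N_morse_rays x0 N" "1 \<le> l" "0 \<le> e" for N l e p
    using that unfolding Q_def N_morse_rays_iff morse_set_def by blast
  have Q_mono: "Q l e B' p" if "Q l e B p" "B \<le> B'" for l e B B' p
    using that unfolding Q_def by (meson order_trans)
  have "\<exists>B. \<forall>p\<in>K. Q l e B p" if l: "1 \<le> l" and e: "0 \<le> e" for l e
  proof (rule ccontr)
    assume "\<not> ?thesis"
    then have "\<forall>n. \<exists>p\<in>K. \<not> Q l e (real n) p" by blast
    then obtain p where p: "\<And>n. p n \<in> K" "\<And>n. \<not> Q l e (real n) (p n)" by metis
    \<comment> \<open>If \<open>p n\<close> has some \<open>N\<close>-Morse representative, then
      \<open>ray (p n)\<close> is Morse for a gauge depending only on \<open>N\<close>. Its value at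
      \<open>(l, e)\<close> must exceed \<open>n\<close>, as the bound \<open>n\<close>
      fails.\<close>
    have fin: "finite {n. \<exists>\<beta>\<in>N_morse_rays x0 N. p n = mclass x0 \<beta>}" if N: "morse_gauge N" for N
    proof (rule finite_subset)
      let ?N' = "hausdorff_gauge N (2 * N 3 1 + 2)"
      show "{n. \<exists>\<beta>\<in>N_morse_rays x0 N. p n = mclass x0 \<beta>} \<subseteq> {..nat \<lceil>?N' l e\<rceil>}"
      proof (intro subsetI, elim CollectE bexE)
        fix n \<beta> assume \<beta>: "\<beta> \<in> N_morse_rays x0 N" "p n = mclass x0 \<beta>"
        have "fin_haus \<beta> (ray (p n))"
          using mclass_eq_iff[OF ray(1)[OF p(1)[of n]]] ray(2)[OF p(1)[of n]] \<beta>(2) by metis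
        moreover have "geodesic_ray_at x0 (ray (p n))"
          using ray(1)[OF p(1)] by (auto simp: morse_ray_at_def N_morse_rays_def)
        ultimately have "ray (p n) \<in> N_morse_rays x0 ?N'"
          using equivalent_rays_morse[OF X N \<beta>(1)] by blast
        then have "\<not> ?N' l e \<le> real n" using Q_mono[OF Q_morse[OF _ l e]] p(2) by blast
        then show "n \<in> {..nat \<lceil>?N' l e\<rceil>}" by simp linarith
      qed
    qed simp
    define A where "A = range p"
    \<comment> \<open>\<open>p\<close> need not be injective, but a class repeated infinitely often
      would put infinitely many indices into the stratum of its ray.\<close>
    have "infinite A"
    proof
      assume "finite A"
      then obtain n0 where n0: "infinite {n. p n = p n0}"
        using pigeonhole_infinite[of UNIV p] unfolding A_def by auto
      obtain N where N: "morse_gauge N" "ray (p n0) \<in> N_morse_rays x0 N"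
        using ray(1)[OF p(1)] unfolding morse_ray_at_def by blast
      have "{n. p n = p n0} \<subseteq> {n. \<exists>\<beta>\<in>N_morse_rays x0 N. p n = mclass x0 \<beta>}"
        using N(2) ray(2)[OF p(1)] by auto
      then show False using n0 fin[OF N(1)] finite_subset by blast
    qed
    moreover have "A \<subseteq> K" using p(1) by (auto simp: A_def)
    ultimately obtain x where x: "x \<in> K"
        "\<And>C. closedin (morse_boundary_top x0) C \<Longrightarrow> A - {x} \<subseteq> C \<Longrightarrow> x \<in> C"
      using compactin_accumulation[OF K] by blast
    have "closedin (morse_boundary_top x0) (A - {x})"
    proof (rule closedin_morse_boundaryI)
      show "A - {x} \<subseteq> morse_boundary x0" using \<open>A \<subseteq> K\<close> KB by blast
      fix N \<beta> assume N: "morse_gauge N" and \<beta>: "\<beta> \<in> N_morse_rays x0 N" "mclass x0 \<beta> \<notin> A - {x}"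
      \<comment> \<open>The stratum of \<open>N\<close> meets \<open>A - {x}\<close> only in this
        finite set, so separating \<beta> from it is enough.\<close>
      define F where "F = (A - {x}) \<inter> mclass x0 ` N_morse_rays x0 N"
      have "F \<subseteq> p ` {n. \<exists>\<beta>\<in>N_morse_rays x0 N. p n = mclass x0 \<beta>}"
        by (auto simp: F_def A_def)
      then have "finite F" using fin[OF N] finite_surj by blast
      moreover have "F \<subseteq> morse_boundary x0" using \<open>A \<subseteq> K\<close> KB by (auto simp: F_def)
      moreover have "mclass x0 \<beta> \<notin> F" using \<beta> by (simp add: F_def)
      ultimately obtain W where "openin compact_open_top W" "\<beta> \<in> W"
          "\<forall>\<beta>'\<in>W \<inter> N_morse_rays x0 N. mclass x0 \<beta>' \<notin> F"
        using separate_from_finite[OF X _ _ \<beta>(1) N] by blast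
      then show "\<exists>W. openin compact_open_top W \<and> \<beta> \<in> W \<and> (\<forall>\<beta>'\<in>W \<inter> N_morse_rays x0 N. mclass x0 \<beta>' \<notin> A - {x})"
        by (intro exI[of _ W]) (auto simp: F_def)
    qed
    then show False using x(2) by blast
  qed
  then obtain B where B: "\<And>l e p. 1 \<le> l \<Longrightarrow> 0 \<le> e \<Longrightarrow> p \<in> K \<Longrightarrow> Q l e (B l e) p" by metis
  define N where "N l e = max 0 (B l e)" for l e :: real
  have "morse_gauge N" by (simp add: morse_gauge_def N_def)
  moreover have "ray p \<in> N_morse_rays x0 N" if p: "p \<in> K" for p
  proof -
    have "Q l e (N l e) p" if "1 \<le> l" "0 \<le> e" for l e
      using Q_mono[OF B[OF that p]] by (simp add: N_def)
    then have "morse_set N (ray p ` {0..})" unfolding morse_set_def Q_def by blast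
    then show ?thesis using ray(1)[OF p] by (auto simp: N_morse_rays_iff morse_ray_at_def)
  qed
  ultimately show ?thesis using that ray(2) by blast
qed

text \<open>Rays converging to \<alpha> have no accumulation class other than that of \<alpha>. So
  their classes without \<open>x\<close>, together with the class of \<alpha>, form a closed set; an
  accumulation point \<open>x\<close> in \<open>K\<close> would belong to it and hence be the class
  of \<alpha>.\<close>

lemma compact_contains_limits:
  fixes x0 :: "'a::metric_space"
  assumes X: "geodesic_space TYPE('a)"
    and K: "compactin (morse_boundary_top x0) K"
    and N: "morse_gauge N" and a: "\<And>n. a n \<in> N_morse_rays x0 N" "\<And>n. mclass x0 (a n) \<in> K"
    and conv: "conv_uc a L \<alpha>" and \<alpha>: "geodesic_ray_at x0 \<alpha>"
  shows "mclass x0 \<alpha> \<in> K"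
proof (rule ccontr)
  assume notin: "mclass x0 \<alpha> \<notin> K"
  have KB: "K \<subseteq> morse_boundary x0"
    using compactin_subset_topspace[OF K] by (simp add: topspace_morse_boundary_top)
  \<comment> \<open>A single gauge for all \<open>a n\<close> and for their limit, since separation
    works within one stratum.\<close>
  define N1 where "N1 l e = max (N l e) (hausdorff_gauge N 1 l e)" for l e
  have N1: "morse_gauge N1" using N by (auto simp: morse_gauge_def N1_def le_max_iff_disj)
  have \<alpha>1: "\<alpha> \<in> N_morse_rays x0 N1"
    by (rule N_morse_rays_mono[OF limit_of_morse_rays[OF a(1) conv \<alpha>]]) (simp add: N1_def)
  have a1: "a n \<in> N_morse_rays x0 N1" for n
    by (rule N_morse_rays_mono[OF a(1)]) (simp add: N1_def)
  have aM: "morse_ray_at x0 (a n)" for n using a(1) N by (auto simp: morse_ray_at_def)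
  define A where "A = range (\<lambda>n. mclass x0 (a n))"
  have AK: "A \<subseteq> K" using a(2) by (auto simp: A_def)
  have "infinite A"
  proof
    assume "finite A"
    then obtain W where W: "openin compact_open_top W" "\<alpha> \<in> W"
        "\<forall>\<beta>'\<in>W \<inter> N_morse_rays x0 N1. mclass x0 \<beta>' \<notin> A"
      using separate_from_finite[OF X _ _ \<alpha>1 N1, of A] AK KB notin by blast
    obtain n where "a n \<in> W"
      using eventually_happens'[OF sequentially_bot conv_uc_eventually_in[OF conv \<alpha> W(1,2)]] by blast
    then show False using W(3) a1 by (auto simp: A_def)
  qed
  then obtain x where x: "x \<in> K"
      "\<And>C. closedin (morse_boundary_top x0) C \<Longrightarrow> A - {x} \<subseteq> C \<Longrightarrow> x \<in> C"
    using compactin_accumulation[OF K _ AK] by blast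
  define C where "C = insert (mclass x0 \<alpha>) (A - {x})"
  have CB: "C \<subseteq> morse_boundary x0"
    using AK KB mclass_in_morse_boundary[OF N1 \<alpha>1] by (auto simp: C_def)
  have "closedin (morse_boundary_top x0) C"
  proof (rule closedin_morse_boundaryI[OF CB])
    fix N' \<beta> assume N': "morse_gauge N'" and \<beta>: "\<beta> \<in> N_morse_rays x0 N'" "mclass x0 \<beta> \<notin> C"
    have "morse_ray_at x0 \<beta>" using \<beta> N' by (auto simp: morse_ray_at_def)
    then have "\<not> fin_haus \<alpha> \<beta>" using mclass_eq_iff[of x0 \<beta> \<alpha>] \<beta>(2) by (auto simp: C_def)
    then obtain V k where V: "openin compact_open_top V" "\<beta> \<in> V"
      "\<And>n \<beta>'. k \<le> n \<Longrightarrow> \<beta>' \<in> V \<Longrightarrow> \<beta>' \<in> N_morse_rays x0 N' \<Longrightarrow> mclass x0 \<beta>' \<noteq> mclass x0 (a n)"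
      using separate_from_limit[OF X aM conv \<beta>(1)] by blast
    \<comment> \<open>\<open>V\<close> avoids the classes of \<open>a n\<close> for \<open>n\<close>
      at least \<open>k\<close>; the finitely many earlier ones are left to \<open>W\<close>. The
      point \<open>x\<close> is taken out because \<beta> may represent it.\<close>
    define F where "F = insert (mclass x0 \<alpha>) ((\<lambda>n. mclass x0 (a n)) ` {..<k} - {x})"
    have F: "finite F" "F \<subseteq> C" by (auto simp: F_def C_def A_def)
    then obtain W where W: "openin compact_open_top W" "\<beta> \<in> W"
        "\<forall>\<beta>'\<in>W \<inter> N_morse_rays x0 N'. mclass x0 \<beta>' \<notin> F"
      using separate_from_finite[OF X F(1) _ \<beta>(1) N'] CB \<beta>(2) by blast
    have "mclass x0 \<beta>' \<notin> C" if "\<beta>' \<in> V \<inter> W" "\<beta>' \<in> N_morse_rays x0 N'" for \<beta>'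
    proof
      assume "mclass x0 \<beta>' \<in> C"
      moreover have "mclass x0 \<beta>' \<notin> F" using W(3) that by blast
      ultimately obtain n where n: "mclass x0 \<beta>' = mclass x0 (a n)" "\<not> n < k"
        by (auto simp: C_def F_def A_def)
      then show False using V(3)[of n \<beta>'] that by auto
    qed
    then show "\<exists>W. openin compact_open_top W \<and> \<beta> \<in> W \<and> (\<forall>\<beta>'\<in>W \<inter> N_morse_rays x0 N'. mclass x0 \<beta>' \<notin> C)"
      using V W by (intro exI[of _ "V \<inter> W"]) auto
  qed
  then have "x \<in> C" using x(2) by (auto simp: C_def)
  then show False using x(1) notin by (auto simp: C_def)
qed

section \<open>Dynamics of the isometries on the Morse boundary\<close>

theorem theorem6p6:
  fixes x0 :: "'a::metric_space"
    and g :: "nat \<Rightarrow> 'a \<Rightarrow> 'a"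
    and p1 p2 :: "(real \<Rightarrow> 'a) set"
    and U K :: "(real \<Rightarrow> 'a) set set"
  assumes "proper_space TYPE('a)" and "geodesic_space TYPE('a)"
    and "\<And>n. isometry_of (g n)"
    and "p1 \<in> morse_boundary x0" and "p2 \<in> morse_boundary x0"
    and "converges_to_boundary x0 (\<lambda>n. g n x0) p1"
    and "converges_to_boundary x0 (\<lambda>n. inv (g n) x0) p2"
    and "openin (morse_boundary_top x0) U" and "p1 \<in> U"
    and "compactin (morse_boundary_top x0) K" and "p2 \<notin> K"
  shows "\<exists>r::nat \<Rightarrow> nat. strict_mono r \<and> (\<exists>k::nat. \<forall>n>k. boundary_act x0 (g (r n)) ` K \<subseteq> U)"
proof (rule ccontr)
  assume contra: "\<not> ?thesis"
  \<comment> \<open>The negated claim is tested at the identity subsequence, which yields failures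
    at arbitrarily large indices.\<close>
  have "\<exists>n>k. \<not> boundary_act x0 (g n) ` K \<subseteq> U" for k
    using contra strict_mono_id[where 'a = nat] by (metis id_apply)
  then have "infinite {n. \<not> boundary_act x0 (g n) ` K \<subseteq> U}"
    by (simp add: infinite_nat_iff_unbounded)
  from infinite_enumerate[OF this] obtain r0 :: "nat \<Rightarrow> nat" where r0: "strict_mono r0"
      and bad: "\<And>n. \<not> boundary_act x0 (g (r0 n)) ` K \<subseteq> U"
    by auto
  have "\<exists>q\<in>K. boundary_act x0 (g (r0 n)) q \<notin> U" for n using bad[of n] by blast
  then obtain q where q: "\<And>n. q n \<in> K" "\<And>n. boundary_act x0 (g (r0 n)) (q n) \<notin> U" by metis
  obtain NK where NK: "morse_gauge NK" "\<And>p. p \<in> K \<Longrightarrow> \<exists>\<alpha>\<in>N_morse_rays x0 NK. p = mclass x0 \<alpha>"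
    using compact_in_stratum[OF assms(2,10)] by blast
  have "\<forall>n. \<exists>\<alpha>. \<alpha> \<in> N_morse_rays x0 NK \<and> q n = mclass x0 \<alpha>" using NK(2)[OF q(1)] by blast
  from choice[OF this] obtain a where a: "\<And>n. a n \<in> N_morse_rays x0 NK" "\<And>n. q n = mclass x0 (a n)"
    by blast
  obtain N1 c1 where N1: "morse_gauge N1"
      and c1: "\<And>n. geodesic_on (c1 n) {0..dist x0 (g n x0)} \<and> c1 n 0 = x0 \<and> c1 n (dist x0 (g n x0)) = g n x0
        \<and> N_morse N1 (c1 n) {0..dist x0 (g n x0)}"
      and lim1: "\<And>r::nat \<Rightarrow> nat. strict_mono r \<Longrightarrow> \<exists>s::nat \<Rightarrow> nat. strict_mono s \<and> (\<exists>\<gamma>. geodesic_ray_at x0 \<gamma>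
        \<and> \<gamma> \<in> p1 \<and> conv_uc (\<lambda>n. c1 (r (s n))) (\<lambda>n. dist x0 (g (r (s n)) x0)) \<gamma>)"
    using assms(6) unfolding converges_to_boundary_def by blast
  obtain N2 c2 where N2: "morse_gauge N2"
      and c2: "\<And>n. geodesic_on (c2 n) {0..dist x0 (inv (g n) x0)} \<and> c2 n 0 = x0
        \<and> c2 n (dist x0 (inv (g n) x0)) = inv (g n) x0 \<and> N_morse N2 (c2 n) {0..dist x0 (inv (g n) x0)}"
      and lim2: "\<And>r::nat \<Rightarrow> nat. strict_mono r \<Longrightarrow> \<exists>s::nat \<Rightarrow> nat. strict_mono s \<and> (\<exists>\<gamma>. geodesic_ray_at x0 \<gamma>
        \<and> \<gamma> \<in> p2 \<and> conv_uc (\<lambda>n. c2 (r (s n))) (\<lambda>n. dist x0 (inv (g (r (s n))) x0)) \<gamma>)"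
    using assms(7) unfolding converges_to_boundary_def by blast
  define N where "N l e = max (NK l e) (max (N1 l e) (N2 l e))" for l e
  have N: "morse_gauge N" using NK(1) by (auto simp: morse_gauge_def N_def le_max_iff_disj)

  have "geodesic_ray_at x0 (a n)" for n using a(1) by (simp add: N_morse_rays_def)
  then obtain r1 L0 \<alpha> where r1: "strict_mono (r1 :: nat \<Rightarrow> nat)" and \<alpha>: "geodesic_ray_at x0 \<alpha>"
      and conv_a: "conv_uc (\<lambda>n. a (r1 n)) L0 \<alpha>"
    using rays_subconverge[OF assms(1)] by blast
  have "strict_mono (\<lambda>n. r0 (r1 n))" using r0 r1 by (simp add: strict_mono_def)
  from lim2[OF this] obtain s2 :: "nat \<Rightarrow> nat" and \<gamma>2 where s2: "strict_mono s2" and \<gamma>2: "\<gamma>2 \<in> p2"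
      and conv2: "conv_uc (\<lambda>n. c2 (r0 (r1 (s2 n)))) (\<lambda>n. dist x0 (inv (g (r0 (r1 (s2 n)))) x0)) \<gamma>2"
    by blast
  have "strict_mono (\<lambda>n. r0 (r1 (s2 n)))" using r0 r1 s2 by (simp add: strict_mono_def)
  from lim1[OF this] obtain s1 :: "nat \<Rightarrow> nat" and \<gamma>1 where s1: "strict_mono s1" and \<gamma>1: "\<gamma>1 \<in> p1"
      and conv1: "conv_uc (\<lambda>n. c1 (r0 (r1 (s2 (s1 n))))) (\<lambda>n. dist x0 (g (r0 (r1 (s2 (s1 n)))) x0)) \<gamma>1"
    by blast
  \<comment> \<open>All data now run along one subsequence. \<open>a\<close> was already indexed
    along \<open>r0\<close>, while \<open>g\<close>, \<open>c1\<close> and \<open>c2\<close> were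
    not.\<close>
  define j where "j n = r1 (s2 (s1 n))" for n
  define h where "h n = g (r0 (j n))" for n
  define b where "b n = a (j n)" for n
  define d where "d n = c2 (r0 (j n))" for n
  define f where "f n = c1 (r0 (j n))" for n
  define L where "L n = dist x0 (h n x0)" for n
  have h: "isometry_of (h n)" for n using assms(3) by (simp add: h_def)
  \<comment> \<open>\<open>L n\<close> thus has two meanings: the time at which the concatenated
    path reaches \<open>x0\<close>, and, after translation by \<open>h n\<close>, the length of the
    geodesic \<open>f n\<close> to \<open>h n x0\<close>.\<close>
  have L_eq: "dist x0 (inv (h n) x0) = L n" for n
    using isometry_dist[OF h[of n], of x0 "inv (h n) x0"] isometry_surj[OF h[of n]]
    by (simp add: L_def dist_commute)
  have b: "b n \<in> N_morse_rays x0 NK" "mclass x0 (b n) \<in> K" "boundary_act x0 (h n) (mclass x0 (b n)) \<notin> U" for n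
    using a(1)[of "j n"] a(2)[of "j n"] q(1)[of "j n"] q(2)[of "j n"] by (simp_all add: b_def h_def)
  have bN: "b n \<in> N_morse_rays x0 N" for n
    by (rule N_morse_rays_mono[OF b(1)]) (simp add: N_def)
  have d: "geodesic_on (d n) {0..L n}" "d n 0 = x0" "d n (L n) = inv (h n) x0" "morse_set N (d n ` {0..L n})" for n
    using c2[of "r0 (j n)"] L_eq[of n] morse_set_mono[of N2 "d n ` {0..L n}" N]
    by (auto simp: d_def h_def N_morse_iff_morse_set N_def)
  have f: "geodesic_on (f n) {0..L n}" "f n 0 = x0" "f n (L n) = h n x0" "morse_set N (f n ` {0..L n})" for n
    using c1[of "r0 (j n)"] morse_set_mono[of N1 "f n ` {0..L n}" N]
    by (auto simp: f_def h_def L_def N_morse_iff_morse_set N_def)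
  have "strict_mono (\<lambda>n. s2 (s1 n))" using s1 s2 by (simp add: strict_mono_def)
  from conv_uc_subseq[OF conv_a this] obtain L1 where conv_b: "conv_uc b L1 \<alpha>"
    by (simp add: b_def[abs_def] j_def)
  have conv_d: "conv_uc d L \<gamma>2"
    using conv_uc_subseq[OF conv2 s1] L_eq by (simp add: d_def[abs_def] h_def j_def)
  have conv_f: "conv_uc f L \<gamma>1"
    using conv1 by (simp add: f_def[abs_def] L_def[abs_def] h_def j_def)

  have "mclass x0 \<alpha> \<in> K"
    by (rule compact_contains_limits[OF assms(2,10) NK(1) b(1,2) conv_b \<alpha>])
  then have not_equiv: "\<not> fin_haus \<alpha> \<gamma>2"
    using mclass_eq_of_mem[OF assms(5) \<gamma>2] mclass_eq_iff[of x0 \<gamma>2 \<alpha>] assms(11) by auto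
  \<comment> \<open>\<open>C\<close> is the divergence threshold of
    \<open>diverging_gromov_product_bound\<close>; the extra 2 pays for replacing \<alpha> and
    \<gamma>2 at time \<open>T\<close> by \<open>b n\<close> and \<open>d n\<close>.\<close>
  define C where "C = 2 * max (N 1 (2 * (4 * N 3 1 + 4))) (4 * N 3 1 + 4) + 2"
  obtain T where T: "0 \<le> T" "C + 2 < dist (\<alpha> T) (\<gamma>2 T)"
    using fin_haus_close[of \<alpha> \<gamma>2 "C + 2"] not_equiv by (meson not_le)
  define M where "M = 2 * (T + N 3 1 + 1)"
  have M: "0 \<le> M" using T morse_gauge_nonneg[OF N, of 3 1] by (simp add: M_def)
  define D where "D = 2 * union_gauge N 1 0 + M + 3"
  have D: "0 \<le> D" using M morse_gauge_nonneg[OF morse_gauge_union[OF N], of 1 0] by (simp add: D_def)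
  define N' where "N' = hausdorff_gauge (union_gauge N) D"
  have "\<forall>\<^sub>F n in sequentially. \<exists>\<beta>. \<beta> \<in> N_morse_rays x0 N' \<and> fin_haus (h n \<circ> b n) \<beta> \<and> dist (\<beta> (L n)) (h n x0) \<le> D"
    using conv_ucD[OF conv_b zero_less_one T(1)] conv_ucD[OF conv_d zero_less_one T(1)]
  proof eventually_elim
    case (elim n)
    then have TL: "T \<le> L n" and "dist (b n T) (\<alpha> T) < 1" "dist (d n T) (\<gamma>2 T) < 1"
      using T(1) by auto
    then have "C < dist (d n T) (b n T)"
      using T(2) dist_triangle[of "\<alpha> T" "\<gamma>2 T" "b n T"] dist_triangle[of "b n T" "\<gamma>2 T" "d n T"]
      by (simp add: dist_commute)
    then have gromov: "L n + t - M \<le> dist (d n (L n)) (b n t)" if "0 \<le> t" for t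
      using diverging_gromov_product_bound[OF assms(2) N d(1,2,4) bN T(1) TL _ that]
      by (simp add: C_def M_def)
    have "h n (d n (L n)) = x0" using d(3) isometry_surj[OF h] by simp
    then show ?case
      using translated_ray[OF assms(1,2) N h bN d(1,2) _ d(4) _ M gromov D_def] T(1) TL
      unfolding N'_def by (metis order_trans)
  qed
  then obtain k0 where "\<And>n. k0 \<le> n \<Longrightarrow>
      \<exists>\<beta>. \<beta> \<in> N_morse_rays x0 N' \<and> fin_haus (h n \<circ> b n) \<beta> \<and> dist (\<beta> (L n)) (h n x0) \<le> D"
    unfolding eventually_sequentially by blast
  then have "\<forall>n. \<exists>\<beta>. \<beta> \<in> N_morse_rays x0 N' \<and> fin_haus (h (n + k0) \<circ> b (n + k0)) \<beta>
      \<and> dist (\<beta> (L (n + k0))) (h (n + k0) x0) \<le> D" by simp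
  then obtain \<beta> where \<beta>: "\<And>n. \<beta> n \<in> N_morse_rays x0 N'" "\<And>n. fin_haus (h (n + k0) \<circ> b (n + k0)) (\<beta> n)"
      "\<And>n. dist (\<beta> n (L (n + k0))) (h (n + k0) x0) \<le> D" by metis
  have N': "morse_gauge N'" unfolding N'_def by (rule morse_gauge_hausdorff[OF D])
  have class_\<beta>: "mclass x0 (\<beta> n) \<notin> U" for n
  proof -
    have "morse_ray_at x0 (b (n + k0))" using b(1) NK(1) by (auto simp: morse_ray_at_def)
    from boundary_act_mclass[OF h this \<beta>(2)] show ?thesis using b(3) by metis
  qed

  have "geodesic_ray_at x0 (\<beta> n)" for n using \<beta>(1) by (simp add: N_morse_rays_def)
  then obtain r3 L3 \<delta> where r3: "strict_mono (r3 :: nat \<Rightarrow> nat)" and \<delta>: "geodesic_ray_at x0 \<delta>"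
      and conv_\<beta>: "conv_uc (\<lambda>n. \<beta> (r3 n)) L3 \<delta>"
    using rays_subconverge[OF assms(1)] by blast
  \<comment> \<open>\<open>\<beta> n\<close> and \<open>f (n + k0)\<close> start together and are
    within \<open>D\<close> of each other at time \<open>L (n + k0)\<close>, so they stay within
    \<open>E\<close> up to that time. As these times tend to infinity, the bound passes to the
    limits \<delta> and \<gamma>1.\<close>
  define E where "E = 2 * max (N 1 (2 * D)) D + 2"
  have \<beta>f: "dist (\<beta> n s) (f (n + k0) s) \<le> E" if s: "0 \<le> s" "s \<le> L (n + k0)" for n s
  proof -
    have L0: "0 \<le> L (n + k0)" by (simp add: L_def)
    have "geodesic_on (\<beta> n) {0..}" "\<beta> n 0 = x0" using \<beta>(1)[of n] by (auto simp: N_morse_rays_iff)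
    then have "geodesic_on (\<beta> n) {0..L (n + k0)}" "\<beta> n 0 = f (n + k0) 0"
      using f(2) by (auto intro: geodesic_on_subset)
    moreover have "quasi_ray 0 (f (n + k0)) {0..L (n + k0)}"
      by (rule geodesic_on_quasi_ray[OF f(1)]) (use L0 in auto)
    moreover have "h (n + k0) x0 \<in> f (n + k0) ` {0..L (n + k0)}"
      using L0 f(3)[of "n + k0"] by (intro image_eqI[of _ _ "L (n + k0)"]) auto
    ultimately show ?thesis
      using geodesic_fellow_travels_quasi_ray[OF f(4)[of "n + k0"], of 0 "\<beta> n" "L (n + k0)" "h (n + k0) x0" D s]
        \<beta>(3)[of n] D s by (simp add: E_def)
  qed
  have "strict_mono (\<lambda>n. r3 n + k0)" using r3 by (simp add: strict_mono_def)
  note conv_f3 = conv_uc_subseq[OF conv_f this]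
  have "fin_haus \<delta> \<gamma>1"
  proof (rule fin_haus_close)
    fix t :: real assume t: "0 \<le> t"
    obtain n where "t \<le> L3 n \<and> (\<forall>s\<in>{0..t}. dist (\<beta> (r3 n) s) (\<delta> s) < 1)"
        "t \<le> L (r3 n + k0) \<and> (\<forall>s\<in>{0..t}. dist (f (r3 n + k0) s) (\<gamma>1 s) < 1)"
      using eventually_happens'[OF sequentially_bot eventually_conj[OF
          conv_ucD[OF conv_\<beta> zero_less_one t] conv_ucD[OF conv_f3 zero_less_one t]]] by blast
    then have "dist (\<beta> (r3 n) t) (\<delta> t) < 1" "dist (f (r3 n + k0) t) (\<gamma>1 t) < 1" "t \<le> L (r3 n + k0)"
      using t by auto
    then show "dist (\<delta> t) (\<gamma>1 t) \<le> E + 2"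
      using \<beta>f[OF t, of "r3 n"] dist_triangle[of "\<delta> t" "\<gamma>1 t" "\<beta> (r3 n) t"]
        dist_triangle[of "\<beta> (r3 n) t" "\<gamma>1 t" "f (r3 n + k0) t"]
      by (simp add: dist_commute)
  qed
  then have "mclass x0 \<delta> = p1"
    using mclass_eq_of_mem[OF assms(4) \<gamma>1] mclass_eq_iff[of x0 \<gamma>1 \<delta>] by simp

  \<comment> \<open>\<delta> and all \<open>\<beta> n\<close> must lie in one stratum, where
    openness of \<open>U\<close> can be applied to them.\<close>
  define N'' where "N'' l e = max (N' l e) (hausdorff_gauge N' 1 l e)" for l e
  have N'': "morse_gauge N''" using N' by (auto simp: morse_gauge_def N''_def le_max_iff_disj)
  have \<delta>'': "\<delta> \<in> N_morse_rays x0 N''"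
    by (rule N_morse_rays_mono[OF limit_of_morse_rays[OF \<beta>(1) conv_\<beta> \<delta>]]) (simp add: N''_def)
  have \<beta>'': "\<beta> n \<in> N_morse_rays x0 N''" for n
    by (rule N_morse_rays_mono[OF \<beta>(1)]) (simp add: N''_def)
  have "openin (subtopology compact_open_top (N_morse_rays x0 N''))
      {\<alpha> \<in> N_morse_rays x0 N''. mclass x0 \<alpha> \<in> U}"
    using assms(8) N'' by (simp add: openin_morse_boundary_top)
  then obtain W where W: "openin compact_open_top W"
      "{\<alpha> \<in> N_morse_rays x0 N''. mclass x0 \<alpha> \<in> U} = W \<inter> N_morse_rays x0 N''"
    unfolding openin_subtopology by blast
  have "\<delta> \<in> W" using W(2) \<delta>'' \<open>mclass x0 \<delta> = p1\<close> assms(9) by blast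
  then obtain n where "\<beta> (r3 n) \<in> W"
    using eventually_happens'[OF sequentially_bot conv_uc_eventually_in[OF conv_\<beta> \<delta> W(1)]] by blast
  then show False using W(2) \<beta>'' class_\<beta> by blast
qed

end
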